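(* Let $G$ be an insoluble para-$\mathfrak{Nil}$-Hamiltonian group and let $X$ be a finite non-nilpotent subgroup of $G$, with normal closure $X^G$ in $G$. (i) If $X^G$ is finite, then $G$ is finite. (ii) If $X\trianglelefteq G$, or if $X\ntrianglelefteq G$ but $X\trianglelefteq X^G$, then $G$ is finite. (iii) If $X^G$ is infinite, then $\gamma_3(G)=\gamma_\infty(G)$, and this subgroup is a finitely generated perfect insoluble group whose quotient by its Fitting subgroup is a non-abelian simple group; moreover, if $\gamma_3(G)$ is minimal non-nilpotent, then $\mathrm{Fit}(\gamma_3(G))=\Phi(\gamma_3(G))$.
   Context: A group is minimal non-nilpotent if it is not nilpotent but all its proper subgroups are nilpotent. A group $G$ is para-$\mathfrak{Nil}$-Hamiltonian if $G$ is non-nilpotent and every non-normal subgroup of $G$ is either nilpotent or minimal non-nilpotent. $X^G$ is the smallest normal subgroup of $G$ containing $X$. $\gamma_i(G)$ is the $i$-th term of the lower central series and $\gamma_\infty(G)=\bigcap_{i\ge1}\gamma_i(G)$. $\mathrm{Fit}(H)$ is the Fitting subgroup (generated by all nilpotent normal subgroups) and $\Phi(H)$ the Frattini subgroup of $H$. A group $H$ is perfect if $H=H'$. *)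

theory Defs
  imports "HOL-Algebra.Algebra"
begin

definition comm_subgroup :: "('a, 'b) monoid_scheme \<Rightarrow> 'a set \<Rightarrow> 'a set \<Rightarrow> 'a set" where
  "comm_subgroup G H K = generate G
     {h \<otimes>\<^bsub>G\<^esub> k \<otimes>\<^bsub>G\<^esub> inv\<^bsub>G\<^esub> h \<otimes>\<^bsub>G\<^esub> inv\<^bsub>G\<^esub> k | h k. h \<in> H \<and> k \<in> K}"

fun lcs :: "('a, 'b) monoid_scheme \<Rightarrow> nat \<Rightarrow> 'a set" where
  "lcs G 0 = carrier G"
| "lcs G (Suc 0) = carrier G"
| "lcs G (Suc (Suc n)) = comm_subgroup G (lcs G (Suc n)) (carrier G)"

definition lcs_infty :: "('a, 'b) monoid_scheme \<Rightarrow> 'a set" where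
  "lcs_infty G = (\<Inter>i\<in>{1..}. lcs G i)"

definition nilpotent_group :: "('a, 'b) monoid_scheme \<Rightarrow> bool" where
  "nilpotent_group G \<longleftrightarrow> group G \<and> (\<exists>n\<ge>1. lcs G n = {\<one>\<^bsub>G\<^esub>})"

definition minimal_non_nilpotent :: "('a, 'b) monoid_scheme \<Rightarrow> bool" where
  "minimal_non_nilpotent G \<longleftrightarrow> group G \<and> \<not> nilpotent_group G \<and>
     (\<forall>H. subgroup H G \<and> H \<noteq> carrier G \<longrightarrow> nilpotent_group (G\<lparr>carrier := H\<rparr>))"

definition para_nil_hamiltonian :: "('a, 'b) monoid_scheme \<Rightarrow> bool" where
  "para_nil_hamiltonian G \<longleftrightarrow> group G \<and> \<not> nilpotent_group G \<and>
     (\<forall>H. subgroup H G \<and> \<not> (normal H G) \<longrightarrow>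
        nilpotent_group (G\<lparr>carrier := H\<rparr>) \<or> minimal_non_nilpotent (G\<lparr>carrier := H\<rparr>))"

definition normal_closure :: "('a, 'b) monoid_scheme \<Rightarrow> 'a set \<Rightarrow> 'a set" where
  "normal_closure G S = {x \<in> carrier G. \<forall>N. normal N G \<and> S \<subseteq> N \<longrightarrow> x \<in> N}"

definition fitting_subgroup :: "('a, 'b) monoid_scheme \<Rightarrow> 'a set" where
  "fitting_subgroup G = generate G
     {x. \<exists>N. normal N G \<and> nilpotent_group (G\<lparr>carrier := N\<rparr>) \<and> x \<in> N}"

definition maximal_subgroup :: "('a, 'b) monoid_scheme \<Rightarrow> 'a set \<Rightarrow> bool" where
  "maximal_subgroup G M \<longleftrightarrow> subgroup M G \<and> M \<noteq> carrier G \<and>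
     (\<forall>K. subgroup K G \<and> M \<subseteq> K \<longrightarrow> K = M \<or> K = carrier G)"

text \<open>Frattini subgroup: intersection of all maximal subgroups (G itself if there are none).\<close>
definition frattini_subgroup :: "('a, 'b) monoid_scheme \<Rightarrow> 'a set" where
  "frattini_subgroup G = {x \<in> carrier G. \<forall>M. maximal_subgroup G M \<longrightarrow> x \<in> M}"

definition perfect_group :: "('a, 'b) monoid_scheme \<Rightarrow> bool" where
  "perfect_group G \<longleftrightarrow> derived G (carrier G) = carrier G"

definition finitely_generated_group :: "('a, 'b) monoid_scheme \<Rightarrow> bool" where
  "finitely_generated_group G \<longleftrightarrow> (\<exists>S. finite S \<and> S \<subseteq> carrier G \<and> generate G S = carrier G)"

text \<open>Simple group, allowing infinite groups (the library locale simple_group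
  requires order G > 1, which fails for infinite groups).\<close>
definition is_simple_group :: "('a, 'b) monoid_scheme \<Rightarrow> bool" where
  "is_simple_group G \<longleftrightarrow> group G \<and> carrier G \<noteq> {\<one>\<^bsub>G\<^esub>} \<and>
     (\<forall>N. normal N G \<longrightarrow> N = carrier G \<or> N = {\<one>\<^bsub>G\<^esub>})"

end

theory Submission
  imports Defs
begin

text \<open>A subgroup properly containing a non-nilpotent one is normal. Hence if \<open>M\<close> is a non-nilpotent
  normal subgroup, all subgroups of \<open>G / M\<close> are normal, so \<open>G / M\<close> has class at most 2: thus
  \<open>\<Gamma> = \<gamma>\<^sub>3(G)\<close> is the least non-nilpotent normal subgroup. Applied to the derived subgroup of \<open>\<Gamma>\<close> this
  shows that \<open>\<Gamma>\<close> is perfect. A non-nilpotent proper normal subgroup of \<open>\<Gamma>\<close> would have cyclic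
  quotient, so proper normal subgroups of \<open>\<Gamma>\<close> are nilpotent, and as \<open>\<Gamma>\<close> is perfect no
  two of them generate \<open>\<Gamma>\<close>; as \<open>\<Gamma>\<close> is finitely generated, their union is the Fitting subgroup and is proper.

  If the normal closure of \<open>X\<close> is finite but \<open>G\<close> is not, take a minimal non-nilpotent \<open>Y \<le> X\<close> and some
  \<open>c \<notin> Y\<close> centralizing \<open>Y\<close>. Then \<open>\<Gamma> \<le> \<langle>Y, c\<rangle>\<close>, so \<open>\<Gamma> = \<Gamma>' \<le> Y\<close>, hence \<open>\<Gamma> = Y\<close> is a finite perfect
  minimal non-nilpotent group, contrary to Schmidt's theorem.\<close>

section \<open>Quotients and commutators\<close>

context group
begin

text \<open>Class at most 2 of \<open>G / M\<close> needs no classification of groups with all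
  subgroups normal: elements act on normal cyclic subgroups by power maps, and power maps commute,
  so commutators act trivially. Finite generation of \<Gamma> is the delicate point of (iii), since
  an infinite perfect group may be the union of its proper normal subgroups. It has to come from X:
  an infinite normal closure makes X non-normal, hence minimal non-nilpotent, so X does not contain
  \<Gamma>; a single element of \<Gamma> outside X, spread by the finitely many elements of X, then
  supplies the generators. In (i) the element c exists because an infinite group acts by conjugation
  on the finite Y with only finitely many outcomes, and minimality of Y turns \<Gamma> \<le> Y into
  equality. For (ii) with X non-normal, the product of X with a conjugate not inside X is a finite
  subgroup properly above X, hence normal, and so contains the normal closure.\<close>

lemma inv_mult_cancel:
  assumes "a \<in> carrier G" "b \<in> carrier G"
  shows "inv a \<otimes> (a \<otimes> b) = b" "a \<otimes> (inv a \<otimes> b) = b"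
  using assms by (simp_all add: m_assoc[symmetric])

lemma commutator_eq_one_iff:
  assumes "a \<in> carrier G" "b \<in> carrier G"
  shows "a \<otimes> b \<otimes> inv a \<otimes> inv b = \<one> \<longleftrightarrow> a \<otimes> b = b \<otimes> a"
proof -
  have "a \<otimes> b \<otimes> inv a \<otimes> inv b = (a \<otimes> b) \<otimes> inv (b \<otimes> a)"
    using assms by (simp add: inv_mult_group m_assoc)
  moreover have "\<one> = (a \<otimes> b) \<otimes> inv (b \<otimes> a) \<longleftrightarrow> a \<otimes> b = \<one> \<otimes> (b \<otimes> a)"
    using assms by (intro inv_solve_right) auto
  moreover have "\<one> \<otimes> (b \<otimes> a) = b \<otimes> a" using assms by (intro l_one) auto
  ultimately show ?thesis by metis
qed

lemma subgroup_sub_iff: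
  assumes "subgroup H G"
  shows "subgroup K (G\<lparr>carrier := H\<rparr>) \<longleftrightarrow> subgroup K G \<and> K \<subseteq> H"
  using incl_subgroup[OF assms, of K] subgroup_incl[OF _ assms, of K]
    subgroup.subset[of K "G\<lparr>carrier := H\<rparr>"] by fastforce

section \<open>Centralizers, and quotients generated by one coset\<close>

lemma subgroup_centralizer:
  assumes "g \<in> carrier G"
  shows "subgroup {h \<in> carrier G. h \<otimes> g = g \<otimes> h} G"
proof (rule subgroupI)
  show "inv a \<in> {h \<in> carrier G. h \<otimes> g = g \<otimes> h}" if "a \<in> {h \<in> carrier G. h \<otimes> g = g \<otimes> h}" for a
  proof -
    have a: "a \<in> carrier G" "a \<otimes> g = g \<otimes> a" using that by auto
    from a(2) have "inv a \<otimes> (a \<otimes> g) \<otimes> inv a = inv a \<otimes> (g \<otimes> a) \<otimes> inv a" by (rule arg_cong)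
    hence "inv a \<otimes> g = g \<otimes> inv a" using a(1) assms by (simp add: m_assoc inv_mult_cancel)
    thus ?thesis using a(1) by simp
  qed
  show "a \<otimes> b \<in> {h \<in> carrier G. h \<otimes> g = g \<otimes> h}"
    if "a \<in> {h \<in> carrier G. h \<otimes> g = g \<otimes> h}" "b \<in> {h \<in> carrier G. h \<otimes> g = g \<otimes> h}" for a b
  proof -
    have ab: "a \<in> carrier G" "b \<in> carrier G" "a \<otimes> g = g \<otimes> a" "b \<otimes> g = g \<otimes> b" using that by auto
    have "a \<otimes> b \<otimes> g = (a \<otimes> g) \<otimes> b" using ab(1,2) assms by (simp add: m_assoc ab(4))
    also have "\<dots> = g \<otimes> (a \<otimes> b)" unfolding ab(3) using ab(1,2) assms by (simp add: m_assoc)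
    finally show ?thesis using ab by simp
  qed
qed (use assms in auto)

text \<open>Two passes through centralizers: the centralizer of a generator contains
  \<open>S\<close>, hence the whole span; so the centralizer of any \<open>a\<close> in the span
  again contains \<open>S\<close>, hence the whole span.\<close>

lemma comm_of_generators:
  assumes "S \<subseteq> carrier G" "\<And>a b. a \<in> S \<Longrightarrow> b \<in> S \<Longrightarrow> a \<otimes> b = b \<otimes> a"
    and "a \<in> generate G S" "b \<in> generate G S"
  shows "a \<otimes> b = b \<otimes> a"
proof -
  have *: "c \<otimes> s = s \<otimes> c" if "c \<in> generate G S" "s \<in> S" for c s
    using generate_subgroup_incl[OF _ subgroup_centralizer[of s], of S] that assms(1,2) by blast
  have "a \<in> carrier G" using assms(1,3) generate_in_carrier by blast
  moreover have "S \<subseteq> {h \<in> carrier G. h \<otimes> a = a \<otimes> h}" using *[OF assms(3)] assms(1) by auto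
  ultimately have "generate G S \<subseteq> {h \<in> carrier G. h \<otimes> a = a \<otimes> h}"
    using generate_subgroup_incl subgroup_centralizer by blast
  thus ?thesis using assms(4) by auto
qed

lemma normal_group_hom_Mod:
  assumes "N \<lhd> G"
  shows "group_hom G (G Mod N) (\<lambda>a. N #> a)"
  using normal.factorgroup_is_group[OF assms] normal.r_coset_hom_Mod[OF assms] is_group
  unfolding group_hom_def group_hom_axioms_def by blast

lemma normal_coset_eq_iff:
  assumes "N \<lhd> G" "a \<in> carrier G"
  shows "N #> a = N \<longleftrightarrow> a \<in> N"
  using assms coset_join1[of N a] coset_join2[of a N] normal_imp_subgroup[OF assms(1)]
    subgroup.subset[OF normal_imp_subgroup[OF assms(1)]] by metis

lemma commutator_mem_iff_comm_Mod:
  assumes "N \<lhd> G" "a \<in> carrier G" "b \<in> carrier G"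
  shows "a \<otimes> b \<otimes> inv a \<otimes> inv b \<in> N \<longleftrightarrow>
    (N #> a) \<otimes>\<^bsub>G Mod N\<^esub> (N #> b) = (N #> b) \<otimes>\<^bsub>G Mod N\<^esub> (N #> a)"
proof -
  interpret h: group_hom G "G Mod N" "\<lambda>a. N #> a" using assms(1) by (rule normal_group_hom_Mod)
  have "N #> (a \<otimes> b \<otimes> inv a \<otimes> inv b) = (N #> a) \<otimes>\<^bsub>G Mod N\<^esub> (N #> b) \<otimes>\<^bsub>G Mod N\<^esub>
     inv\<^bsub>G Mod N\<^esub> (N #> a) \<otimes>\<^bsub>G Mod N\<^esub> inv\<^bsub>G Mod N\<^esub> (N #> b)"
    using assms by (simp del: mult_FactGroup)
  thus ?thesis using h.H.commutator_eq_one_iff[OF h.hom_closed[OF assms(2)] h.hom_closed[OF assms(3)]]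
    normal_coset_eq_iff[OF assms(1), of "a \<otimes> b \<otimes> inv a \<otimes> inv b"] assms(2,3)
    by (simp del: mult_FactGroup)
qed

text \<open>The image of \<open>insert x N\<close> in the quotient is one coset besides the
  identity, so the quotient is abelian. Combined with perfectness: a perfect group never arises from
  a proper normal subgroup by adding one element.\<close>

lemma derived_subset_if_cyclic_Mod:
  assumes "N \<lhd> G" "x \<in> carrier G" "generate G (insert x N) = carrier G"
  shows "derived G (carrier G) \<subseteq> N"
proof -
  interpret h: group_hom G "G Mod N" "\<lambda>a. N #> a" using assms(1) by (rule normal_group_hom_Mod)
  interpret N: normal N G by fact
  have S: "insert x N \<subseteq> carrier G" using assms(2) N.subset by auto
  have im: "(\<lambda>a. N #> a) ` insert x N \<subseteq> {N #> x, \<one>\<^bsub>G Mod N\<^esub>}"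
    using normal_coset_eq_iff[OF assms(1)] N.subset by auto
  have gen: "N #> a \<in> generate (G Mod N) {N #> x, \<one>\<^bsub>G Mod N\<^esub>}" if "a \<in> carrier G" for a
    using h.generate_img[OF S] h.mono_generate[OF im] assms(3) that by auto
  have "(N #> a) \<otimes>\<^bsub>G Mod N\<^esub> (N #> b) = (N #> b) \<otimes>\<^bsub>G Mod N\<^esub> (N #> a)"
    if "a \<in> carrier G" "b \<in> carrier G" for a b
  proof (rule h.H.comm_of_generators[OF _ _ gen[OF that(1)] gen[OF that(2)]])
    show "{N #> x, \<one>\<^bsub>G Mod N\<^esub>} \<subseteq> carrier (G Mod N)"
      using h.hom_closed[OF assms(2)] h.H.one_closed by blast
    show "u \<otimes>\<^bsub>G Mod N\<^esub> v = v \<otimes>\<^bsub>G Mod N\<^esub> u"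
      if "u \<in> {N #> x, \<one>\<^bsub>G Mod N\<^esub>}" "v \<in> {N #> x, \<one>\<^bsub>G Mod N\<^esub>}" for u v
      using that h.H.l_one[OF h.hom_closed[OF assms(2)]] h.H.r_one[OF h.hom_closed[OF assms(2)]]
      by (metis insertE singletonD)
  qed
  hence "derived_set G (carrier G) \<subseteq> N"
    using commutator_mem_iff_comm_Mod[OF assms(1)] by auto
  thus ?thesis unfolding derived_def
    using generate_subgroup_incl N.subgroup_axioms by blast
qed

section \<open>Conjugation as a homomorphism, and power maps\<close>

lemma conj_hom:
  assumes "c \<in> carrier G"
  shows "group_hom G G (\<lambda>y. c \<otimes> y \<otimes> inv c)"
proof -
  have "c \<otimes> (x \<otimes> y) \<otimes> inv c = (c \<otimes> x \<otimes> inv c) \<otimes> (c \<otimes> y \<otimes> inv c)"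
    if "x \<in> carrier G" "y \<in> carrier G" for x y
    using that assms by (simp add: m_assoc inv_mult_cancel)
  thus ?thesis using assms is_group
    unfolding group_hom_def group_hom_axioms_def hom_def by auto
qed

lemma conj_mult:
  assumes "c \<in> carrier G" "d \<in> carrier G" "x \<in> carrier G"
  shows "(c \<otimes> d) \<otimes> x \<otimes> inv (c \<otimes> d) = c \<otimes> (d \<otimes> x \<otimes> inv d) \<otimes> inv c"
  using assms by (simp add: inv_mult_group m_assoc)

text \<open>Both sides equal \<open>x [^] (i * j)\<close>: a conjugation is a homomorphism, so it
  raises every power of \<open>x\<close> to the same exponent, and integer multiplication
  commutes.\<close>

lemma power_actions_commute:
  fixes i j :: int
  assumes "a \<in> carrier G" "b \<in> carrier G" "x \<in> carrier G"
    and "a \<otimes> x \<otimes> inv a = x [^] i" "b \<otimes> x \<otimes> inv b = x [^] j"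
  shows "(a \<otimes> b) \<otimes> x \<otimes> inv (a \<otimes> b) = (b \<otimes> a) \<otimes> x \<otimes> inv (b \<otimes> a)"
proof -
  have "c \<otimes> x [^] k \<otimes> inv c = (c \<otimes> x \<otimes> inv c) [^] k" if "c \<in> carrier G" for c and k :: int
    using group_hom.hom_int_pow[OF conj_hom[OF that] assms(3)] .
  thus ?thesis
    using assms conj_mult by (simp add: int_pow_pow mult.commute)
qed

text \<open>Elements act on cyclic subgroups by powering, and such actions commute.\<close>

lemma commutator_central_if_all_cyclic_normal:
  assumes "\<And>x. x \<in> carrier G \<Longrightarrow> generate G {x} \<lhd> G"
    and "a \<in> carrier G" "b \<in> carrier G" "x \<in> carrier G"
  shows "(a \<otimes> b \<otimes> inv a \<otimes> inv b) \<otimes> x = x \<otimes> (a \<otimes> b \<otimes> inv a \<otimes> inv b)"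
proof -
  \<comment> \<open>The commutator is \<open>(a \<otimes> b) \<otimes> inv v\<close>. Conjugating
    \<open>x\<close> by \<open>inv v\<close> gives \<open>y\<close>; on \<open>y\<close> the
    elements \<open>a \<otimes> b\<close> and \<open>v = b \<otimes> a\<close> act alike, and
    \<open>v\<close> carries \<open>y\<close> back to \<open>x\<close>.\<close>
  define v where "v = b \<otimes> a"
  define y where "y = inv v \<otimes> x \<otimes> v"
  have v: "v \<in> carrier G" and y: "y \<in> carrier G" using assms(2-4) by (auto simp: v_def y_def)
  have act: "\<exists>i::int. c \<otimes> y \<otimes> inv c = y [^] i" if "c \<in> carrier G" for c
    using normal.inv_op_closed2[OF assms(1)[OF y] that, of y] generate_pow[OF y]
    by (auto intro: generate.incl)
  obtain i j :: int where "a \<otimes> y \<otimes> inv a = y [^] i" "b \<otimes> y \<otimes> inv b = y [^] j"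
    using act assms(2,3) by blast
  hence "(a \<otimes> b) \<otimes> y \<otimes> inv (a \<otimes> b) = v \<otimes> y \<otimes> inv v"
    using power_actions_commute assms(2,3) y unfolding v_def by blast
  also have "v \<otimes> y \<otimes> inv v = x"
    using v assms(4) unfolding y_def by (simp add: m_assoc inv_mult_cancel)
  finally have "(a \<otimes> b) \<otimes> (inv v \<otimes> x \<otimes> v) \<otimes> inv (a \<otimes> b) = x" unfolding y_def .
  moreover have "(a \<otimes> b) \<otimes> (inv v \<otimes> x \<otimes> v) \<otimes> inv (a \<otimes> b) =
      (a \<otimes> b \<otimes> inv v) \<otimes> x \<otimes> inv (a \<otimes> b \<otimes> inv v)"
    using assms(2-4) v by (simp add: inv_mult_group m_assoc)
  moreover have "a \<otimes> b \<otimes> inv v = a \<otimes> b \<otimes> inv a \<otimes> inv b"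
    using assms(2-4) by (simp add: v_def inv_mult_group m_assoc)
  ultimately have "(a \<otimes> b \<otimes> inv a \<otimes> inv b) \<otimes> x \<otimes> inv (a \<otimes> b \<otimes> inv a \<otimes> inv b) = x" by simp
  thus ?thesis
    using assms(2-4) inv_solve_right[of x "(a \<otimes> b \<otimes> inv a \<otimes> inv b) \<otimes> x" "a \<otimes> b \<otimes> inv a \<otimes> inv b"]
    by simp
qed

end

section \<open>Lower central series and nilpotency\<close>

context group
begin

lemma lcs_2: "lcs G 2 = comm_subgroup G (carrier G) (carrier G)"
  by (simp add: numeral_eq_Suc)

lemma lcs_3: "lcs G 3 = comm_subgroup G (lcs G 2) (carrier G)"
  by (simp add: numeral_eq_Suc)

lemma comm_subgroup_mono:
  assumes "H \<subseteq> H'" "K \<subseteq> K'"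
  shows "comm_subgroup G H K \<subseteq> comm_subgroup G H' K'"
  unfolding comm_subgroup_def by (rule mono_generate) (use assms in blast)

lemma derived_eq_comm_subgroup: "derived G H = comm_subgroup G H H"
  unfolding derived_def comm_subgroup_def by (rule arg_cong[where f = "generate G"]) blast

lemma comm_subgroup_normal:
  assumes "H \<lhd> G" "K \<lhd> G"
  shows "comm_subgroup G H K \<lhd> G"
  unfolding comm_subgroup_def
proof (rule normal_generateI)
  interpret H: normal H G by fact
  interpret K: normal K G by fact
  show "{h \<otimes> k \<otimes> inv h \<otimes> inv k |h k. h \<in> H \<and> k \<in> K} \<subseteq> carrier G"
    using H.subset K.subset by auto
  fix c g assume "c \<in> {h \<otimes> k \<otimes> inv h \<otimes> inv k |h k. h \<in> H \<and> k \<in> K}" and g: "g \<in> carrier G"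
  then obtain h k where hk: "h \<in> H" "k \<in> K" "c = h \<otimes> k \<otimes> inv h \<otimes> inv k" by blast
  interpret c: group_hom G G "\<lambda>y. g \<otimes> y \<otimes> inv g" using g by (rule conj_hom)
  have [simp]: "h \<in> carrier G" "k \<in> carrier G" using hk by auto
  define h' k' where "h' = g \<otimes> h \<otimes> inv g" and "k' = g \<otimes> k \<otimes> inv g"
  have "g \<otimes> c \<otimes> inv g = h' \<otimes> k' \<otimes> inv h' \<otimes> inv k'"
    unfolding hk(3) h'_def k'_def
    by (simp only: c.hom_mult c.hom_inv m_closed inv_closed \<open>h \<in> carrier G\<close> \<open>k \<in> carrier G\<close>)
  moreover have "h' \<in> H" "k' \<in> K"
    using H.inv_op_closed2[OF g hk(1)] K.inv_op_closed2[OF g hk(2)] by (auto simp: h'_def k'_def)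
  ultimately show "g \<otimes> c \<otimes> inv g \<in> {h \<otimes> k \<otimes> inv h \<otimes> inv k |h k. h \<in> H \<and> k \<in> K}"
    by blast
qed

lemma lcs_normal: "lcs G n \<lhd> G"
  by (induction n rule: induct_nat_012) (simp_all add: normal_self comm_subgroup_normal)

lemma comm_subgroup_consistent:
  assumes "subgroup L G" "H \<subseteq> L" "K \<subseteq> L"
  shows "comm_subgroup (G\<lparr>carrier := L\<rparr>) H K = comm_subgroup G H K"
proof -
  interpret L: subgroup L G by fact
  have eq: "{h \<otimes>\<^bsub>G\<lparr>carrier := L\<rparr>\<^esub> k \<otimes>\<^bsub>G\<lparr>carrier := L\<rparr>\<^esub> inv\<^bsub>G\<lparr>carrier := L\<rparr>\<^esub> h
        \<otimes>\<^bsub>G\<lparr>carrier := L\<rparr>\<^esub> inv\<^bsub>G\<lparr>carrier := L\<rparr>\<^esub> k |h k. h \<in> H \<and> k \<in> K}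
      = {h \<otimes> k \<otimes> inv h \<otimes> inv k |h k. h \<in> H \<and> k \<in> K}"
    using assms(2,3) m_inv_consistent[OF assms(1)] by (intro Collect_cong ex_cong1) (auto simp: subset_iff)
  have "{h \<otimes> k \<otimes> inv h \<otimes> inv k |h k. h \<in> H \<and> k \<in> K} \<subseteq> L"
    using assms(2,3) by (auto simp: subset_iff)
  thus ?thesis unfolding comm_subgroup_def eq
    using generate_consistent[OF _ assms(1)] by blast
qed

lemma lcs_subgroup_subset:
  assumes "subgroup K G"
  shows "lcs (G\<lparr>carrier := K\<rparr>) n \<subseteq> lcs G n"
proof (induction n rule: induct_nat_012)
  case (ge2 n)
  interpret K: group "G\<lparr>carrier := K\<rparr>" using assms by (rule subgroup_imp_group)
  have "lcs (G\<lparr>carrier := K\<rparr>) (Suc n) \<subseteq> K"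
    using subgroup.subset[OF normal_imp_subgroup[OF K.lcs_normal]] by simp
  thus ?case using ge2 comm_subgroup_consistent[OF assms] comm_subgroup_mono
      subgroup.subset[OF assms] by simp
qed (use subgroup.subset[OF assms] in auto)

lemma nilpotent_subgroup:
  assumes "nilpotent_group G" "subgroup K G"
  shows "nilpotent_group (G\<lparr>carrier := K\<rparr>)"
proof -
  interpret K: group "G\<lparr>carrier := K\<rparr>" using assms(2) by (rule subgroup_imp_group)
  obtain n where n: "n \<ge> 1" "lcs G n = {\<one>}" using assms(1) by (auto simp: nilpotent_group_def)
  have "\<one> \<in> lcs (G\<lparr>carrier := K\<rparr>) n"
    using subgroup.one_closed[OF normal_imp_subgroup[OF K.lcs_normal]] by simp
  hence "lcs (G\<lparr>carrier := K\<rparr>) n = {\<one>}" using lcs_subgroup_subset[OF assms(2), of n] n by auto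
  thus ?thesis using n K.is_group by (auto simp: nilpotent_group_def)
qed

lemma nilpotent_subset:
  assumes "nilpotent_group (G\<lparr>carrier := H\<rparr>)" "subgroup H G" "subgroup K G" "K \<subseteq> H"
  shows "nilpotent_group (G\<lparr>carrier := K\<rparr>)"
  using group.nilpotent_subgroup[OF subgroup_imp_group[OF assms(2)] assms(1), of K]
    subgroup_sub_iff[OF assms(2)] assms(3,4) by simp

text \<open>The index shift arises because the lower central series starts at 1 with the whole
  group, while the derived series starts at exponent 0.\<close>

lemma exp_derived_subset_lcs: "(derived G ^^ n) (carrier G) \<subseteq> lcs G (Suc n)"
proof (induction n)
  case (Suc n)
  have "(derived G ^^ n) (carrier G) \<subseteq> carrier G" by (rule exp_of_derived_in_carrier) simp
  hence "comm_subgroup G ((derived G ^^ n) (carrier G)) ((derived G ^^ n) (carrier G)) \<subseteq>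
      comm_subgroup G (lcs G (Suc n)) (carrier G)"
    using Suc by (intro comm_subgroup_mono)
  thus ?case using derived_eq_comm_subgroup[of "(derived G ^^ n) (carrier G)"] by simp
qed simp

lemma nilpotent_imp_solvable:
  assumes "nilpotent_group G" shows "solvable G"
proof -
  obtain n where n: "lcs G (Suc n) = {\<one>}"
    using assms unfolding nilpotent_group_def by (metis Suc_le_D One_nat_def)
  have "(derived G ^^ n) (carrier G) = {\<one>}"
    using exp_derived_subset_lcs[of n] n subgroup.one_closed[OF exp_of_derived_is_subgroup[OF subgroup_self]]
    by blast
  thus ?thesis using solvable_iff_trivial_derived_seq by blast
qed

lemma exp_derived_consistent:
  assumes "subgroup H G"
  shows "(derived (G\<lparr>carrier := H\<rparr>) ^^ n) H = (derived G ^^ n) H"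
proof (induction n)
  case (Suc n)
  have "(derived (G\<lparr>carrier := H\<rparr>) ^^ n) H \<subseteq> H"
    using group.exp_of_derived_in_carrier[OF subgroup_imp_group[OF assms], of H] by simp
  thus ?case using Suc derived_consistent[OF _ assms] by simp
qed simp

text \<open>The form in which nilpotency is played against perfectness and insolubility. The
  iterates are taken in \<open>G\<close>, so they can be compared between subgroups and pushed into
  quotients.\<close>

lemma nilpotent_subgroup_exp_derived:
  assumes "subgroup H G" "nilpotent_group (G\<lparr>carrier := H\<rparr>)"
  obtains n where "(derived G ^^ n) H = {\<one>}"
proof -
  interpret H: group "G\<lparr>carrier := H\<rparr>" using assms(1) by (rule subgroup_imp_group)
  show ?thesis using H.nilpotent_imp_solvable[OF assms(2)] exp_derived_consistent[OF assms(1)] that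
    unfolding H.solvable_iff_trivial_derived_seq by auto
qed

lemma subgroup_not_nilpotent_mono:
  assumes "subgroup H G" "\<not> nilpotent_group (G\<lparr>carrier := H\<rparr>)" "subgroup K G" "H \<subseteq> K"
  shows "\<not> nilpotent_group (G\<lparr>carrier := K\<rparr>)"
  using nilpotent_subset assms by blast

lemma minimal_non_nilpotent_subgroup:
  assumes "subgroup K G" "minimal_non_nilpotent (G\<lparr>carrier := K\<rparr>)" "subgroup H G" "H \<subset> K"
  shows "nilpotent_group (G\<lparr>carrier := H\<rparr>)"
proof -
  have "nilpotent_group ((G\<lparr>carrier := K\<rparr>)\<lparr>carrier := H\<rparr>)"
    using assms subgroup_sub_iff[OF assms(1), of H] unfolding minimal_non_nilpotent_def by auto
  thus ?thesis by simp
qed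

text \<open>Cyclic subgroups of the quotient pull back to overgroups of \<open>M\<close>, so they
  are normal; then commutators in the quotient are central, and the third term of the series dies
  there.\<close>

lemma lcs_3_subset_if_overgroups_normal:
  assumes M: "M \<lhd> G" and over: "\<And>H. subgroup H G \<Longrightarrow> M \<subseteq> H \<Longrightarrow> H \<lhd> G"
  shows "lcs G 3 \<subseteq> M"
proof -
  interpret M: normal M G by fact
  let ?Q = "G Mod M"
  interpret h: group_hom G ?Q "\<lambda>a. M #> a" using M by (rule normal_group_hom_Mod)
  have surj: "(\<lambda>a. M #> a) ` carrier G = carrier ?Q"
    by (auto simp: FactGroup_def RCOSETS_def)
  have cyc: "generate ?Q {Y} \<lhd> ?Q" if Y: "Y \<in> carrier ?Q" for Y
  proof -
    let ?C = "generate ?Q {Y}"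
    have C: "subgroup ?C ?Q" using Y by (intro h.H.generate_is_subgroup) auto
    let ?H = "{g \<in> carrier G. M #> g \<in> ?C}"
    have "subgroup ?H G"
      using h.one_closed subgroup.one_closed[OF C] subgroup.m_closed[OF C] subgroup.m_inv_closed[OF C]
      by (intro subgroupI) (auto simp del: mult_FactGroup one_FactGroup intro: exI[of _ \<one>])
    moreover have "M \<subseteq> ?H"
    proof
      fix t assume t: "t \<in> M"
      hence "M #> t = M" using normal_coset_eq_iff[OF M, of t] by auto
      hence "M #> t \<in> ?C" using subgroup.one_closed[OF C] unfolding one_FactGroup by metis
      thus "t \<in> ?H" using M.mem_carrier[OF t] by blast
    qed
    ultimately have "?H \<lhd> G" by (rule over)
    \<comment> \<open>Normality passes to the image because the projection is surjective; for the
      same reason the image of the preimage is all of \<open>?C\<close>.\<close>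
    hence "(\<lambda>a. M #> a) ` ?H \<lhd> ?Q"
      using h.group_hom_axioms surj by (rule normal.surj_hom_normal_subgroup)
    moreover have "(\<lambda>a. M #> a) ` ?H = ?C"
    proof
      show "?C \<subseteq> (\<lambda>a. M #> a) ` ?H"
      proof
        fix c assume c: "c \<in> ?C"
        hence "c \<in> (\<lambda>a. M #> a) ` carrier G" using surj subgroup.subset[OF C] by blast
        thus "c \<in> (\<lambda>a. M #> a) ` ?H" using c by blast
      qed
    qed blast
    ultimately show ?thesis by simp
  qed
  \<comment> \<open>The centralizer of \<open>Z\<close> is a subgroup, so only the images of the
    generating commutators of \<open>lcs G 2\<close> have to be tested.\<close>
  have c2: "(M #> h) \<otimes>\<^bsub>?Q\<^esub> Z = Z \<otimes>\<^bsub>?Q\<^esub> (M #> h)" if "h \<in> lcs G 2" "Z \<in> carrier ?Q" for h Z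
  proof -
    let ?S = "{h \<otimes> k \<otimes> inv h \<otimes> inv k |h k. h \<in> carrier G \<and> k \<in> carrier G}"
    have S: "?S \<subseteq> carrier G" by auto
    have "(\<lambda>a. M #> a) ` ?S \<subseteq> {h \<in> carrier ?Q. h \<otimes>\<^bsub>?Q\<^esub> Z = Z \<otimes>\<^bsub>?Q\<^esub> h}"
    proof
      fix u assume "u \<in> (\<lambda>a. M #> a) ` ?S"
      then obtain a b where ab: "a \<in> carrier G" "b \<in> carrier G" "u = M #> (a \<otimes> b \<otimes> inv a \<otimes> inv b)" by blast
      have "u = (M #> a) \<otimes>\<^bsub>?Q\<^esub> (M #> b) \<otimes>\<^bsub>?Q\<^esub> inv\<^bsub>?Q\<^esub> (M #> a) \<otimes>\<^bsub>?Q\<^esub> inv\<^bsub>?Q\<^esub> (M #> b)"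
        unfolding ab(3) using ab(1,2) by (simp del: mult_FactGroup)
      thus "u \<in> {h \<in> carrier ?Q. h \<otimes>\<^bsub>?Q\<^esub> Z = Z \<otimes>\<^bsub>?Q\<^esub> h}"
        using h.H.commutator_central_if_all_cyclic_normal[OF cyc, of "M #> a" "M #> b" Z] that(2)
          h.hom_closed[OF ab(1)] h.hom_closed[OF ab(2)]
        by (simp del: mult_FactGroup)
    qed
    hence "(\<lambda>a. M #> a) ` generate G ?S \<subseteq> {h \<in> carrier ?Q. h \<otimes>\<^bsub>?Q\<^esub> Z = Z \<otimes>\<^bsub>?Q\<^esub> h}"
      unfolding h.generate_img[OF S, symmetric]
      using h.H.subgroup_centralizer[OF that(2)] by (rule h.H.generate_subgroup_incl)
    thus ?thesis using that(1) unfolding lcs_2 comm_subgroup_def by blast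
  qed
  have "lcs G 2 \<subseteq> carrier G" using lcs_normal normal_imp_subgroup subgroup.subset by blast
  hence "h \<otimes> k \<otimes> inv h \<otimes> inv k \<in> M" if "h \<in> lcs G 2" "k \<in> carrier G" for h k
    using that by (intro iffD2[OF commutator_mem_iff_comm_Mod[OF M]] c2 h.hom_closed) auto
  hence "{h \<otimes> k \<otimes> inv h \<otimes> inv k |h k. h \<in> lcs G 2 \<and> k \<in> carrier G} \<subseteq> M" by auto
  thus ?thesis unfolding lcs_3 comm_subgroup_def
    using M.subgroup_axioms by (rule generate_subgroup_incl)
qed

end

section \<open>Schmidt's theorem\<close>

text \<open>This is the normalizer of \<open>D\<close>. The equivalence replaces a mere inclusion,
  which for infinite \<open>D\<close> would not be preserved under inverses.\<close>

definition conj_stabilizer :: "('a, 'b) monoid_scheme \<Rightarrow> 'a set \<Rightarrow> 'a set" where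
  "conj_stabilizer G D =
     {g \<in> carrier G. \<forall>d\<in>carrier G. d \<in> D \<longleftrightarrow> g \<otimes>\<^bsub>G\<^esub> d \<otimes>\<^bsub>G\<^esub> inv\<^bsub>G\<^esub> g \<in> D}"

context group
begin

lemma conj_inv_cancel:
  assumes "g \<in> carrier G" "d \<in> carrier G"
  shows "g \<otimes> (inv g \<otimes> d \<otimes> g) \<otimes> inv g = d" "inv g \<otimes> (g \<otimes> d \<otimes> inv g) \<otimes> g = d"
  using assms by (simp_all add: m_assoc inv_mult_cancel)

lemma subgroup_conj_stabilizer: "subgroup (conj_stabilizer G D) G"
proof (rule subgroupI)
  show "inv g \<in> conj_stabilizer G D" if "g \<in> conj_stabilizer G D" for g
  proof -
    have g: "g \<in> carrier G" "\<And>d. d \<in> carrier G \<Longrightarrow> d \<in> D \<longleftrightarrow> g \<otimes> d \<otimes> inv g \<in> D"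
      using that unfolding conj_stabilizer_def by blast+
    have "d \<in> D \<longleftrightarrow> inv g \<otimes> d \<otimes> g \<in> D" if "d \<in> carrier G" for d
      using g(2)[of "inv g \<otimes> d \<otimes> g"] conj_inv_cancel(1)[OF g(1) that] g(1) that by simp
    thus ?thesis using g(1) by (simp add: conj_stabilizer_def)
  qed
  show "g \<otimes> h \<in> conj_stabilizer G D" if "g \<in> conj_stabilizer G D" "h \<in> conj_stabilizer G D" for g h
  proof -
    have g: "g \<in> carrier G" "\<And>d. d \<in> carrier G \<Longrightarrow> d \<in> D \<longleftrightarrow> g \<otimes> d \<otimes> inv g \<in> D"
      and h: "h \<in> carrier G" "\<And>d. d \<in> carrier G \<Longrightarrow> d \<in> D \<longleftrightarrow> h \<otimes> d \<otimes> inv h \<in> D"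
      using that unfolding conj_stabilizer_def by blast+
    have "d \<in> D \<longleftrightarrow> g \<otimes> h \<otimes> d \<otimes> inv (g \<otimes> h) \<in> D" if "d \<in> carrier G" for d
      unfolding conj_mult[OF g(1) h(1) that] using h(2)[OF that]
      by (rule trans) (use g(2)[of "h \<otimes> d \<otimes> inv h"] h(1) that in auto)
    thus ?thesis using g(1) h(1) by (simp add: conj_stabilizer_def)
  qed
  have "\<one> \<in> conj_stabilizer G D" by (simp add: conj_stabilizer_def)
  thus "conj_stabilizer G D \<noteq> {}" by blast
qed (auto simp: conj_stabilizer_def)

lemma conj_stabilizerI:
  assumes "g \<in> carrier G" "\<And>d. d \<in> D \<Longrightarrow> g \<otimes> d \<otimes> inv g \<in> D" "\<And>d. d \<in> D \<Longrightarrow> inv g \<otimes> d \<otimes> g \<in> D"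
  shows "g \<in> conj_stabilizer G D"
proof -
  have "d \<in> D" if "d \<in> carrier G" "g \<otimes> d \<otimes> inv g \<in> D" for d
    using assms(3)[OF that(2)] conj_inv_cancel(2)[OF assms(1) that(1)] by simp
  thus ?thesis using assms(1,2) unfolding conj_stabilizer_def by blast
qed

lemma subset_conj_stabilizer:
  assumes "subgroup D G" shows "D \<subseteq> conj_stabilizer G D"
proof
  interpret D: subgroup D G by fact
  fix g assume "g \<in> D"
  thus "g \<in> conj_stabilizer G D" by (intro conj_stabilizerI) auto
qed

lemma normal_if_conj_stabilizer:
  assumes "subgroup D G" "conj_stabilizer G D = carrier G"
  shows "D \<lhd> G"
  unfolding normal_inv_iff
proof (intro conjI ballI)
  fix x h assume x: "x \<in> carrier G" and h: "h \<in> D"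
  have "x \<in> conj_stabilizer G D" unfolding assms(2) by (rule x)
  moreover have "h \<in> carrier G" using h by (rule subgroup.mem_carrier[OF assms(1)])
  ultimately show "x \<otimes> h \<otimes> inv x \<in> D" using h unfolding conj_stabilizer_def by blast
qed fact

text \<open>Descend the lower central series to the place where it enters \<open>D\<close>: an
  element \<open>x\<close> of the last term not inside \<open>D\<close> has all its commutators with
  \<open>D\<close> in the next term, hence in \<open>D\<close>. The same holds for
  \<open>inv x\<close>, which is recorded because \<open>D\<close> may be infinite.\<close>

lemma nilpotent_normalizer_condition:
  assumes "nilpotent_group G" "subgroup D G" "D \<noteq> carrier G"
  shows "\<exists>x\<in>carrier G - D. \<forall>d\<in>D. x \<otimes> d \<otimes> inv x \<in> D \<and> inv x \<otimes> d \<otimes> x \<in> D"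
proof -
  interpret D: subgroup D G by fact
  obtain m where "lcs G (Suc m) = {\<one>}"
    using assms(1) unfolding nilpotent_group_def by (metis Suc_le_D One_nat_def)
  hence "lcs G (Suc m) \<subseteq> D" by simp
  moreover have "\<not> lcs G (Suc 0) \<subseteq> D" using assms(3) D.subset by auto
  ultimately obtain n where n: "\<not> lcs G (Suc n) \<subseteq> D" "lcs G (Suc (Suc n)) \<subseteq> D"
    by (induction m) auto
  then obtain x where x: "x \<in> lcs G (Suc n)" "x \<notin> D" by blast
  interpret L: subgroup "lcs G (Suc n)" G using lcs_normal normal_imp_subgroup by blast
  have *: "y \<otimes> d \<otimes> inv y \<in> D" if y: "y \<in> lcs G (Suc n)" and d: "d \<in> D" for y d
  proof -
    have "y \<otimes> d \<otimes> inv y \<otimes> inv d \<in> lcs G (Suc (Suc n))"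
      using y d D.subset unfolding lcs.simps comm_subgroup_def by (intro generate.incl) blast
    hence "y \<otimes> d \<otimes> inv y \<otimes> inv d \<otimes> d \<in> D" using n(2) d by blast
    thus ?thesis using y d by (simp add: m_assoc)
  qed
  have "inv x \<in> lcs G (Suc n)" using x(1) by blast
  from *[OF this] *[OF x(1)] show ?thesis using x by (intro bexI[of _ x]) auto
qed

lemma nilpotent_subgroup_normalizer_grows:
  assumes "subgroup M G" "nilpotent_group (G\<lparr>carrier := M\<rparr>)" "subgroup D G" "D \<subset> M"
  obtains x where "x \<in> M" "x \<notin> D" "x \<in> conj_stabilizer G D"
proof -
  interpret M: subgroup M G by fact
  have "subgroup D (G\<lparr>carrier := M\<rparr>)" "D \<noteq> M" using subgroup_sub_iff[OF assms(1)] assms(3,4) by auto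
  hence "\<exists>x\<in>M - D. \<forall>d\<in>D. x \<otimes> d \<otimes> inv\<^bsub>G\<lparr>carrier := M\<rparr>\<^esub> x \<in> D \<and> inv\<^bsub>G\<lparr>carrier := M\<rparr>\<^esub> x \<otimes> d \<otimes> x \<in> D"
    using group.nilpotent_normalizer_condition[OF subgroup_imp_group[OF assms(1)] assms(2), of D] by simp
  then obtain x where x: "x \<in> M" "x \<notin> D"
    "\<And>d. d \<in> D \<Longrightarrow> x \<otimes> d \<otimes> inv\<^bsub>G\<lparr>carrier := M\<rparr>\<^esub> x \<in> D \<and> inv\<^bsub>G\<lparr>carrier := M\<rparr>\<^esub> x \<otimes> d \<otimes> x \<in> D"
    by blast
  have "x \<in> conj_stabilizer G D"
    using x m_inv_consistent[OF assms(1) x(1)] by (intro conj_stabilizerI) auto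
  thus ?thesis using that x by blast
qed

section \<open>Conjugates of maximal subgroups\<close>

lemma conj_image_subset_iff:
  assumes "g \<in> carrier G" "H \<subseteq> carrier G" "K \<subseteq> carrier G"
  shows "(\<lambda>y. g \<otimes> y \<otimes> inv g) ` H \<subseteq> K \<longleftrightarrow> H \<subseteq> (\<lambda>y. inv g \<otimes> y \<otimes> g) ` K"
proof
  show "H \<subseteq> (\<lambda>y. inv g \<otimes> y \<otimes> g) ` K" if "(\<lambda>y. g \<otimes> y \<otimes> inv g) ` H \<subseteq> K"
  proof
    fix h assume h: "h \<in> H"
    hence "h = inv g \<otimes> (g \<otimes> h \<otimes> inv g) \<otimes> g" using conj_inv_cancel assms by auto
    thus "h \<in> (\<lambda>y. inv g \<otimes> y \<otimes> g) ` K" using that h by blast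
  qed
  show "(\<lambda>y. g \<otimes> y \<otimes> inv g) ` H \<subseteq> K" if sub: "H \<subseteq> (\<lambda>y. inv g \<otimes> y \<otimes> g) ` K"
  proof
    fix x assume "x \<in> (\<lambda>y. g \<otimes> y \<otimes> inv g) ` H"
    then obtain k where "k \<in> K" "x = g \<otimes> (inv g \<otimes> k \<otimes> g) \<otimes> inv g" using sub by blast
    thus "x \<in> K" using conj_inv_cancel(1)[OF assms(1), of k] assms(3) by auto
  qed
qed

lemma conj_image_conj_image:
  assumes "g \<in> carrier G" "H \<subseteq> carrier G"
  shows "(\<lambda>y. g \<otimes> y \<otimes> inv g) ` ((\<lambda>y. inv g \<otimes> y \<otimes> g) ` H) = H"
proof -
  have "(\<lambda>y. g \<otimes> (inv g \<otimes> y \<otimes> g) \<otimes> inv g) ` H = (\<lambda>y. y) ` H"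
    using conj_inv_cancel(1)[OF assms(1)] assms(2) by (intro image_cong) auto
  thus ?thesis by (simp add: image_image)
qed

text \<open>A subgroup above the conjugate is pulled back by \<open>inv g\<close> to a subgroup
  above \<open>M\<close>, where maximality of \<open>M\<close> decides.\<close>

lemma maximal_subgroup_conj:
  assumes "maximal_subgroup G M" "g \<in> carrier G"
  shows "maximal_subgroup G ((\<lambda>y. g \<otimes> y \<otimes> inv g) ` M)"
proof -
  have M: "subgroup M G" "M \<noteq> carrier G" "\<And>K. subgroup K G \<Longrightarrow> M \<subseteq> K \<Longrightarrow> K = M \<or> K = carrier G"
    using assms(1) by (auto simp: maximal_subgroup_def)
  interpret c: group_hom G G "\<lambda>y. g \<otimes> y \<otimes> inv g" using assms(2) by (rule conj_hom)
  interpret c': group_hom G G "\<lambda>y. inv g \<otimes> y \<otimes> g" using conj_hom[of "inv g"] assms(2) by simp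
  have sub: "M \<subseteq> carrier G" using M(1) subgroup.subset by blast
  have car: "(\<lambda>y. g \<otimes> y \<otimes> inv g) ` carrier G = carrier G"
  proof
    have "(\<lambda>y. inv g \<otimes> y \<otimes> g) ` carrier G \<subseteq> carrier G" using assms(2) by auto
    from image_mono[OF this, of "\<lambda>y. g \<otimes> y \<otimes> inv g"] show "carrier G \<subseteq> (\<lambda>y. g \<otimes> y \<otimes> inv g) ` carrier G"
      unfolding conj_image_conj_image[OF assms(2) subset_refl] .
  qed (use assms(2) in auto)
  show ?thesis unfolding maximal_subgroup_def
  proof (intro conjI allI impI)
    show "subgroup ((\<lambda>y. g \<otimes> y \<otimes> inv g) ` M) G" using c.subgroup_img_is_subgroup[OF M(1)] .
    show "(\<lambda>y. g \<otimes> y \<otimes> inv g) ` M \<noteq> carrier G"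
    proof
      assume eq: "(\<lambda>y. g \<otimes> y \<otimes> inv g) ` M = carrier G"
      have "carrier G \<subseteq> M"
      proof
        fix x assume x: "x \<in> carrier G"
        hence "g \<otimes> x \<otimes> inv g \<in> (\<lambda>y. g \<otimes> y \<otimes> inv g) ` M" using eq assms(2) by simp
        then obtain y where y: "y \<in> M" "g \<otimes> x \<otimes> inv g = g \<otimes> y \<otimes> inv g" by blast
        have "inv g \<otimes> (g \<otimes> x \<otimes> inv g) \<otimes> g = inv g \<otimes> (g \<otimes> y \<otimes> inv g) \<otimes> g" using y(2) by (rule arg_cong)
        hence "x = y" using conj_inv_cancel(2)[OF assms(2)] x y(1) sub by auto
        thus "x \<in> M" using y by simp
      qed
      thus False using M(2) sub by blast
    qed
    fix K assume K: "subgroup K G \<and> (\<lambda>y. g \<otimes> y \<otimes> inv g) ` M \<subseteq> K"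
    have Ksub: "K \<subseteq> carrier G" using K subgroup.subset by blast
    have "M \<subseteq> (\<lambda>y. inv g \<otimes> y \<otimes> g) ` K" using K conj_image_subset_iff[OF assms(2) sub Ksub] by blast
    moreover have "subgroup ((\<lambda>y. inv g \<otimes> y \<otimes> g) ` K) G" using K c'.subgroup_img_is_subgroup by blast
    ultimately have "(\<lambda>y. inv g \<otimes> y \<otimes> g) ` K = M \<or> (\<lambda>y. inv g \<otimes> y \<otimes> g) ` K = carrier G" using M(3) by blast
    thus "K = (\<lambda>y. g \<otimes> y \<otimes> inv g) ` M \<or> K = carrier G"
      using conj_image_conj_image[OF assms(2) Ksub] car by metis
  qed
qed

end

context group
begin

section \<open>Finite groups: maximal subgroups and counting conjugates\<close>

lemma finite_maximal_subgroup_above: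
  assumes "finite (carrier G)" "subgroup H G" "H \<noteq> carrier G"
  obtains M where "maximal_subgroup G M" "H \<subseteq> M"
proof -
  let ?A = "{K. subgroup K G \<and> K \<noteq> carrier G}"
  have "?A \<subseteq> Pow (carrier G)" using subgroup.subset by blast
  hence fin: "finite ?A" using assms(1) by (meson finite_Pow_iff finite_subset)
  have H: "H \<in> ?A" using assms(2,3) by blast
  obtain M where M: "M \<in> ?A" "H \<subseteq> M" "\<forall>K\<in>?A. M \<subseteq> K \<longrightarrow> M = K"
    using finite_has_maximal2[OF fin H] by blast
  hence "maximal_subgroup G M" unfolding maximal_subgroup_def by blast
  thus ?thesis using that M(2) by blast
qed

lemma finite_maximal_normal:
  assumes "finite (carrier G)" "carrier G \<noteq> {\<one>}"
  obtains N where "N \<lhd> G" "N \<noteq> carrier G" "\<And>K. K \<lhd> G \<Longrightarrow> N \<subseteq> K \<Longrightarrow> K \<noteq> carrier G \<Longrightarrow> K = N"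
proof -
  let ?A = "{K. K \<lhd> G \<and> K \<noteq> carrier G}"
  have "?A \<subseteq> Pow (carrier G)" using normal_imp_subgroup subgroup.subset by blast
  hence fin: "finite ?A" using assms(1) by (meson finite_Pow_iff finite_subset)
  have one: "{\<one>} \<in> ?A" using one_is_normal assms(2) by blast
  obtain N where N: "N \<in> ?A" "\<forall>K\<in>?A. N \<subseteq> K \<longrightarrow> N = K"
    using finite_has_maximal2[OF fin one] by blast
  show ?thesis
  proof (rule that)
    show "N \<lhd> G" "N \<noteq> carrier G" using N(1) by blast+
    show "K = N" if "K \<lhd> G" "N \<subseteq> K" "K \<noteq> carrier G" for K using N(2) that by blast
  qed
qed

text \<open>Double counting of the map
  \<open>(g, m) \<mapsto> g \<otimes> m \<otimes> inv g\<close>, all of whose fibres have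
  \<open>card M\<close> elements. \<open>TI\<close> says that conjugates sharing an element outside
  \<open>N\<close> come from one left coset of \<open>M\<close>; in effect there are
  \<open>card (carrier G) / card M\<close> conjugates, each contributing
  \<open>card M - card N\<close> elements.\<close>

lemma card_conjugates_of_TI_subgroup:
  assumes fin: "finite (carrier G)" and M: "subgroup M G" and N: "N \<lhd> G" "N \<subseteq> M"
    and TI: "\<And>x g h. g \<in> carrier G \<Longrightarrow> h \<in> carrier G \<Longrightarrow> x \<notin> N \<Longrightarrow> x \<in> (\<lambda>y. g \<otimes> y \<otimes> inv g) ` M \<Longrightarrow>
        x \<in> (\<lambda>y. h \<otimes> y \<otimes> inv h) ` M \<Longrightarrow> inv g \<otimes> h \<in> M"
  shows "card {g \<otimes> m \<otimes> inv g |g m. g \<in> carrier G \<and> m \<in> M - N} * card M = card (carrier G) * (card M - card N)"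
proof -
  interpret M: subgroup M G by fact
  interpret N: normal N G by fact
  define f where "f p = fst p \<otimes> snd p \<otimes> inv (fst p)" for p
  let ?A = "carrier G \<times> (M - N)"
  have finM: "finite M" using fin M.subset finite_subset by blast
  have finA: "finite ?A" using fin finM by simp
  have U: "{g \<otimes> m \<otimes> inv g |g m. g \<in> carrier G \<and> m \<in> M - N} = f ` ?A"
    unfolding f_def image_def by fastforce
  have fib: "card {p \<in> ?A. f p = u} = card M" if u: "u \<in> f ` ?A" for u
  proof -
    obtain g m where gm: "g \<in> carrier G" "m \<in> M" "m \<notin> N" "u = g \<otimes> m \<otimes> inv g"
      using u unfolding f_def by auto
    have mc: "m \<in> carrier G" using gm(2) by (rule M.mem_carrier)
    have uN: "u \<notin> N"
      using N.inv_op_closed1[OF gm(1), of u] gm(3,4) conj_inv_cancel(2)[OF gm(1) mc] by auto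
    \<comment> \<open>Each \<open>k\<close> in \<open>M\<close> gives another way to write
      \<open>u\<close>, as the conjugate by \<open>g \<otimes> k\<close> of
      \<open>inv k \<otimes> m \<otimes> k\<close>. By \<open>TI\<close> there are no others:
      \<open>k\<close> is recovered from a pair \<open>(h, m')\<close> as
      \<open>inv g \<otimes> h\<close>.\<close>
    let ?\<phi> = "\<lambda>k. (g \<otimes> k, inv k \<otimes> m \<otimes> k)"
    have "{p \<in> ?A. f p = u} = ?\<phi> ` M"
    proof
      show "?\<phi> ` M \<subseteq> {p \<in> ?A. f p = u}"
      proof
        fix p assume "p \<in> ?\<phi> ` M"
        then obtain k where k: "k \<in> M" "p = (g \<otimes> k, inv k \<otimes> m \<otimes> k)" by blast
        have kc: "k \<in> carrier G" using k(1) by (rule M.mem_carrier)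
        have "inv k \<otimes> m \<otimes> k \<notin> N"
          using N.inv_op_closed2[OF kc, of "inv k \<otimes> m \<otimes> k"] conj_inv_cancel(1)[OF kc mc] gm(3) by auto
        moreover have "g \<otimes> k \<otimes> (inv k \<otimes> m \<otimes> k) \<otimes> inv (g \<otimes> k) = u"
          using conj_mult[OF gm(1) kc, of "inv k \<otimes> m \<otimes> k"] conj_inv_cancel(1)[OF kc mc] gm(4) kc mc by simp
        ultimately show "p \<in> {p \<in> ?A. f p = u}"
          using k gm(1,2) by (simp add: f_def)
      qed
      show "{p \<in> ?A. f p = u} \<subseteq> ?\<phi> ` M"
      proof
        fix p assume p: "p \<in> {p \<in> ?A. f p = u}"
        obtain h m' where hm: "p = (h, m')" by (cases p)
        have h: "h \<in> carrier G" "m' \<in> M" "u = h \<otimes> m' \<otimes> inv h" using p unfolding hm f_def by auto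
        have m'c: "m' \<in> carrier G" using h(2) by (rule M.mem_carrier)
        have k: "inv g \<otimes> h \<in> M"
          using TI[OF gm(1) h(1) uN] gm(2,4) h(2,3) by blast
        have eq1: "g \<otimes> (inv g \<otimes> h) = h" using gm(1) h(1) by (simp add: inv_mult_cancel)
        have "inv (inv g \<otimes> h) \<otimes> m \<otimes> (inv g \<otimes> h) = inv h \<otimes> (g \<otimes> m \<otimes> inv g) \<otimes> h"
          using gm(1) h(1) mc by (simp add: inv_mult_group m_assoc)
        also have "\<dots> = inv h \<otimes> (h \<otimes> m' \<otimes> inv h) \<otimes> h" unfolding gm(4)[symmetric] h(3)[symmetric] ..
        also have "\<dots> = m'" by (rule conj_inv_cancel(2)[OF h(1) m'c])
        finally show "p \<in> ?\<phi> ` M" using k eq1 hm by (intro image_eqI[of _ _ "inv g \<otimes> h"]) auto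
      qed
    qed
    moreover have "inj_on ?\<phi> M" using gm(1) M.subset by (auto intro!: inj_onI simp: subset_iff)
    ultimately show ?thesis by (simp add: card_image)
  qed
  have "card ?A = (\<Sum>u\<in>f ` ?A. card {p \<in> ?A. f p = u})"
    using sum.image_gen[OF finA, of "\<lambda>_. 1::nat" f] by simp
  also have "\<dots> = card (f ` ?A) * card M" using fib by simp
  finally have "card (f ` ?A) * card M = card (carrier G) * card (M - N)"
    by (simp add: card_cartesian_product)
  thus ?thesis unfolding U using card_Diff_subset[OF finite_subset[OF N(2) finM] N(2)] by simp
qed

text \<open>Modulo a maximal normal subgroup \<open>N\<close>, distinct
  maximal subgroups intersect trivially by the normalizer condition; hence the conjugates of a single
  maximal subgroup cover at least half, but not all, of the elements outside \<open>N\<close>, and two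
  non-conjugate maximal subgroups would cover too many.\<close>

lemma finite_perfect_has_non_nilpotent_proper_subgroup:
  assumes fin: "finite (carrier G)" and perf: "derived G (carrier G) = carrier G" and nontriv: "carrier G \<noteq> {\<one>}"
  shows "\<exists>H. subgroup H G \<and> H \<noteq> carrier G \<and> \<not> nilpotent_group (G\<lparr>carrier := H\<rparr>)"
proof (rule ccontr)
  assume "\<not> ?thesis"
  hence nil: "\<And>H. subgroup H G \<Longrightarrow> H \<noteq> carrier G \<Longrightarrow> nilpotent_group (G\<lparr>carrier := H\<rparr>)" by blast
  obtain N where N: "N \<lhd> G" "N \<noteq> carrier G" "\<And>K. K \<lhd> G \<Longrightarrow> N \<subseteq> K \<Longrightarrow> K \<noteq> carrier G \<Longrightarrow> K = N"
    using finite_maximal_normal[OF fin nontriv] by blast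
  interpret N: normal N G by fact
  define Mx where "Mx = {M. maximal_subgroup G M \<and> N \<subseteq> M}"
  have Mx: "subgroup M G" "M \<noteq> carrier G" "N \<subseteq> M" if "M \<in> Mx" for M
    using that unfolding Mx_def maximal_subgroup_def by auto
  have Mx_carrier: "M \<subseteq> carrier G" if "M \<in> Mx" for M
    using Mx(1)[OF that] by (rule subgroup.subset)
  have Mx_max: "K = M \<or> K = carrier G" if "M \<in> Mx" "subgroup K G" "M \<subseteq> K" for M K
    using that unfolding Mx_def maximal_subgroup_def by blast
  have above: "\<exists>M\<in>Mx. H \<subseteq> M" if H: "subgroup H G" "H \<noteq> carrier G" "N \<subseteq> H" for H
  proof -
    obtain M where M: "maximal_subgroup G M" "H \<subseteq> M"
      by (rule finite_maximal_subgroup_above[OF fin H(1,2)])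
    hence "M \<in> Mx" using H(3) unfolding Mx_def by simp
    thus ?thesis using M(2) by (rule bexI[rotated])
  qed
  \<comment> \<open>Otherwise the quotient by \<open>N\<close> would be cyclic, and perfectness
    would give \<open>N = carrier G\<close>. This is what later puts every element into a proper
    subgroup above \<open>N\<close>.\<close>
  have gen_ne: "generate G (insert x N) \<noteq> carrier G" if "x \<in> carrier G" for x
    using derived_subset_if_cyclic_Mod[OF N(1) that] perf N(2) N.subset by auto
  have gen_sub: "subgroup (generate G (insert x N)) G" if "x \<in> carrier G" for x
    using that N.subset by (intro generate_is_subgroup) auto
  have gen_incl: "insert x N \<subseteq> generate G (insert x N)" for x
    using generate.incl by (rule subsetI)
  have cover: "\<exists>M\<in>Mx. x \<in> M" if "x \<in> carrier G" for x
  proof -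
    have "N \<subseteq> generate G (insert x N)" using gen_incl[of x] by blast
    from above[OF gen_sub[OF that] gen_ne[OF that] this] show ?thesis using gen_incl[of x] by blast
  qed
  \<comment> \<open>For \<open>x\<close> outside \<open>N\<close>, the span of \<open>x\<close> and
    \<open>N\<close> lies strictly between \<open>N\<close> and the group, so \<open>N\<close> is
    not a maximal subgroup.\<close>
  have ne_N: "M \<noteq> N" if "M \<in> Mx" for M
  proof
    assume "M = N"
    obtain x where x: "x \<in> carrier G" "x \<notin> N" using N(2) N.subset by blast
    have "generate G (insert x N) = N"
      using Mx_max[OF that gen_sub[OF x(1)]] gen_incl[of x] gen_ne[OF x(1)] unfolding \<open>M = N\<close> by blast
    thus False using gen_incl[of x] x(2) by blast
  qed
  have not_normal: "\<not> M \<lhd> G" if "M \<in> Mx" for M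
    using N(3)[of M] Mx(2,3)[OF that] ne_N[OF that] by blast
  \<comment> \<open>The normalizer lies between the maximal subgroup \<open>M\<close> and
    \<open>G\<close>, and it is not \<open>G\<close> because \<open>N\<close> is the only proper
    normal subgroup above \<open>N\<close>.\<close>
  have self_norm: "conj_stabilizer G M = M" if "M \<in> Mx" for M
    using Mx_max[OF that subgroup_conj_stabilizer subset_conj_stabilizer[OF Mx(1)[OF that]]]
      normal_if_conj_stabilizer[OF Mx(1)[OF that]] not_normal[OF that] by blast
  have int: "M1 \<inter> M2 = N" if "M1 \<in> Mx" "M2 \<in> Mx" "M1 \<noteq> M2" for M1 M2
  proof (rule ccontr)
    assume ne: "M1 \<inter> M2 \<noteq> N"
    \<comment> \<open>Take an inclusion-maximal bad intersection \<open>D\<close>. It is not normal,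
      by maximality of \<open>N\<close>, so its normalizer is proper and lies in some
      \<open>C\<close> of \<open>Mx\<close>.\<close>
    let ?P = "{A \<inter> B |A B. A \<in> Mx \<and> B \<in> Mx \<and> A \<noteq> B \<and> A \<inter> B \<noteq> N}"
    have "?P \<subseteq> Pow (carrier G)" using Mx_carrier by blast
    hence finP: "finite ?P" using fin by (meson finite_Pow_iff finite_subset)
    have neP: "?P \<noteq> {}" using that ne by blast
    from finite_has_maximal[OF finP neP] obtain D where D: "D \<in> ?P" "\<forall>E\<in>?P. D \<subseteq> E \<longrightarrow> D = E"
      by (rule bexE)
    from D(1) obtain A B where AB: "A \<in> Mx" "B \<in> Mx" "A \<noteq> B" "D = A \<inter> B" "D \<noteq> N" by blast
    have subD: "subgroup D G" unfolding AB(4) using AB Mx(1) by (intro subgroups_Inter_pair)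
    have ND: "N \<subseteq> D" using AB Mx(3) by blast
    have "D \<noteq> carrier G" using AB Mx(2) Mx_carrier by blast
    hence "\<not> D \<lhd> G" using N(3)[OF _ ND] AB(5) by blast
    hence "conj_stabilizer G D \<noteq> carrier G" using normal_if_conj_stabilizer[OF subD] by blast
    moreover have "N \<subseteq> conj_stabilizer G D" using ND subset_conj_stabilizer[OF subD] by blast
    ultimately obtain C where C: "C \<in> Mx" "conj_stabilizer G D \<subseteq> C" using above[OF subgroup_conj_stabilizer] by blast
    have DC: "D \<subseteq> C" using C(2) subset_conj_stabilizer[OF subD] by blast
    \<comment> \<open>\<open>E\<close> is nilpotent, so the normalizer of \<open>D\<close> inside
      \<open>E\<close> exceeds \<open>D\<close> and lies in \<open>C\<close>. If \<open>E\<close>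
      differed from \<open>C\<close>, then \<open>E \<inter> C\<close> would be a larger bad
      intersection. Applied to both \<open>A\<close> and \<open>B\<close>, this forces
      \<open>A = C = B\<close>.\<close>
    have *: "E = C" if E: "E \<in> Mx" "D \<subset> E" for E
    proof (rule ccontr)
      assume "E \<noteq> C"
      obtain x where x: "x \<in> E" "x \<notin> D" "x \<in> conj_stabilizer G D"
        using nilpotent_subgroup_normalizer_grows[OF Mx(1)[OF E(1)] nil[OF Mx(1,2)[OF E(1)]] subD E(2)] by blast
      have sub: "D \<subseteq> E \<inter> C" "E \<inter> C \<noteq> D" using x C(2) DC E(2) by blast+
      hence "E \<inter> C \<noteq> N" using ND AB(5) by blast
      hence "E \<inter> C \<in> ?P" using E(1) C(1) \<open>E \<noteq> C\<close> by blast
      thus False using D(2) sub by blast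
    qed
    have "D \<noteq> A" using Mx_max[OF AB(1) Mx(1)[OF AB(2)]] Mx(2)[OF AB(2)] AB(3,4) by blast
    moreover have "D \<noteq> B" using Mx_max[OF AB(2) Mx(1)[OF AB(1)]] Mx(2)[OF AB(1)] AB(3,4) by blast
    ultimately show False using *[OF AB(1)] *[OF AB(2)] AB(3,4) by blast
  qed
  let ?c = "\<lambda>g M. (\<lambda>y. g \<otimes> y \<otimes> inv g) ` M"
  have conj_Mx: "?c g M \<in> Mx" if "M \<in> Mx" "g \<in> carrier G" for M g
  proof -
    have "N \<subseteq> ?c g M"
    proof
      fix n assume n: "n \<in> N"
      hence "inv g \<otimes> n \<otimes> g \<in> M" using N.inv_op_closed1[OF that(2)] Mx(3)[OF that(1)] by blast
      moreover have "n = g \<otimes> (inv g \<otimes> n \<otimes> g) \<otimes> inv g" using conj_inv_cancel(1)[OF that(2)] n by simp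
      ultimately show "n \<in> ?c g M" by blast
    qed
    thus ?thesis using maximal_subgroup_conj[OF _ that(2)] that(1) unfolding Mx_def by blast
  qed
  have meet: "?c g M = ?c h M'"
    if "M \<in> Mx" "M' \<in> Mx" "g \<in> carrier G" "h \<in> carrier G" "x \<notin> N" "x \<in> ?c g M" "x \<in> ?c h M'" for M M' g h x
    using int[OF conj_Mx[OF that(1,3)] conj_Mx[OF that(2,4)]] that(5-7) by blast
  \<comment> \<open>Needed twice: with \<open>M' = M\<close> it shows that
    \<open>inv g \<otimes> h\<close> normalizes \<open>M\<close>; with two different subgroups it
    carries an element of \<open>M'\<close> into \<open>M\<close>.\<close>
  have conj_mem: "inv g \<otimes> h \<otimes> m \<otimes> inv (inv g \<otimes> h) \<in> M"
    if "M \<in> Mx" "M' \<in> Mx" "g \<in> carrier G" "h \<in> carrier G" "?c g M = ?c h M'" "m \<in> M'" for M M' g h m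
  proof -
    have mc: "m \<in> carrier G" using that Mx_carrier by blast
    have "h \<otimes> m \<otimes> inv h \<in> ?c g M" unfolding that(5) using that(6) by blast
    then obtain m' where m': "m' \<in> M" "h \<otimes> m \<otimes> inv h = g \<otimes> m' \<otimes> inv g" by blast
    have m'c: "m' \<in> carrier G" using m'(1) that(1) Mx_carrier by blast
    have "inv g \<otimes> h \<otimes> m \<otimes> inv (inv g \<otimes> h) = inv g \<otimes> (h \<otimes> m \<otimes> inv h) \<otimes> g"
      using conj_mult[OF inv_closed[OF that(3)] that(4) mc] that(3) by simp
    also have "\<dots> = m'" unfolding m'(2) by (rule conj_inv_cancel(2)[OF that(3) m'c])
    finally show ?thesis using m'(1) by simp
  qed
  define U where "U M = {g \<otimes> m \<otimes> inv g |g m. g \<in> carrier G \<and> m \<in> M - N}" for M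
  have inv_mul: "inv (inv g \<otimes> h) = inv h \<otimes> g" if "g \<in> carrier G" "h \<in> carrier G" for g h
    using that by (simp add: inv_mult_group)
  have card_U: "card (U M) * card M = card (carrier G) * (card M - card N)" if M: "M \<in> Mx" for M
    unfolding U_def
  proof (rule card_conjugates_of_TI_subgroup[OF fin Mx(1)[OF M] N(1) Mx(3)[OF M]])
    fix x g h assume gh: "g \<in> carrier G" "h \<in> carrier G" and x: "x \<notin> N" "x \<in> ?c g M" "x \<in> ?c h M"
    note eq = meet[OF M M gh x]
    have "inv g \<otimes> h \<in> conj_stabilizer G M"
    proof (rule conj_stabilizerI)
      show "inv g \<otimes> h \<in> carrier G" using gh by simp
      show "inv g \<otimes> h \<otimes> d \<otimes> inv (inv g \<otimes> h) \<in> M" if "d \<in> M" for d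
        using conj_mem[OF M M gh eq that] .
      show "inv (inv g \<otimes> h) \<otimes> d \<otimes> (inv g \<otimes> h) \<in> M" if "d \<in> M" for d
        using conj_mem[OF M M gh(2,1) eq[symmetric] that] inv_mul gh by simp
    qed
    thus "inv g \<otimes> h \<in> M" using self_norm[OF M] by blast
  qed
  have U_sub: "U M \<subseteq> carrier G - N" if M: "M \<in> Mx" for M
  proof
    fix u assume "u \<in> U M"
    then obtain g m where gm: "g \<in> carrier G" "m \<in> M" "m \<notin> N" "u = g \<otimes> m \<otimes> inv g" unfolding U_def by blast
    have mc: "m \<in> carrier G" using gm(2) Mx_carrier[OF M] by blast
    have "u \<notin> N" using N.inv_op_closed1[OF gm(1), of u] gm(3,4) conj_inv_cancel(2)[OF gm(1) mc] by auto
    thus "u \<in> carrier G - N" using gm(1,4) mc by simp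
  qed
  have finN: "finite N" using fin N.subset finite_subset by blast
  have cN: "card N > 0" using finN N.one_closed by (metis card_gt_0_iff empty_iff)
  \<comment> \<open>The factor 2 is Lagrange: \<open>card N\<close> is a proper divisor of
    \<open>card M\<close>.\<close>
  have card_M: "2 * card N \<le> card M" "card M < card (carrier G)" if M: "M \<in> Mx" for M
  proof -
    have finM: "finite M" using fin Mx_carrier[OF M] finite_subset by blast
    have "card N < card M" using finM Mx(3)[OF M] ne_N[OF M] by (intro psubset_card_mono) auto
    moreover have "card N dvd card M"
    proof -
      have "subgroup N (G\<lparr>carrier := M\<rparr>)"
        using subgroup_sub_iff[OF Mx(1)[OF M]] N.subgroup_axioms Mx(3)[OF M] by blast
      from group.lagrange[OF subgroup_imp_group[OF Mx(1)[OF M]] this]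
      have "card N dvd order (G\<lparr>carrier := M\<rparr>)" by (rule subst) (rule dvd_triv_right)
      thus ?thesis by (simp add: order_def)
    qed
    ultimately show "2 * card N \<le> card M" by (auto elim!: dvdE)
    show "card M < card (carrier G)" using fin Mx(2)[OF M] Mx_carrier[OF M] by (intro psubset_card_mono) auto
  qed
  \<comment> \<open>By \<open>card_U\<close>, the set \<open>U M\<close> makes up the proportion
    \<open>1 - card N / card M\<close> of the group, and this is at least one half.\<close>
  have half: "card (carrier G) \<le> 2 * card (U M)" if M: "M \<in> Mx" for M
  proof -
    have "card (carrier G) * card M \<le> card (carrier G) * (2 * (card M - card N))"
      using card_M(1)[OF M] by (intro mult_le_mono2) auto
    also have "\<dots> = 2 * card (U M) * card M" using card_U[OF M] by simp
    finally show ?thesis using card_M(1)[OF M] cN by simp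
  qed
  obtain M where M: "M \<in> Mx" using cover by blast
  \<comment> \<open>Equality would force \<open>card M = card (carrier G)\<close>: the number of
    elements missed by \<open>U M\<close> is \<open>card N\<close> times the index of
    \<open>M\<close>, not \<open>card N\<close>.\<close>
  have "U M \<noteq> carrier G - N"
  proof
    assume "U M = carrier G - N"
    hence "card (U M) = card (carrier G) - card N" using finN N.subset by (simp add: card_Diff_subset)
    hence *: "(card (carrier G) - card N) * card M = card (carrier G) * (card M - card N)" using card_U[OF M] by simp
    have "card N * card M = card (carrier G) * card N"
    proof -
      \<comment> \<open>These bounds make the truncated subtractions of natural numbers
        genuine.\<close>
      have "card N * card M \<le> card (carrier G) * card M" "card (carrier G) * card N \<le> card (carrier G) * card M"
        using card_M[OF M] by (auto intro: mult_le_mono)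
      thus ?thesis using * unfolding diff_mult_distrib diff_mult_distrib2 by linarith
    qed
    thus False using card_M(2)[OF M] cN by simp
  qed
  then obtain x where x: "x \<in> carrier G" "x \<notin> N" "x \<notin> U M" using U_sub[OF M] by blast
  obtain M' where M': "M' \<in> Mx" "x \<in> M'" using cover[OF x(1)] by blast
  \<comment> \<open>A common element would make \<open>M\<close> and \<open>M'\<close> conjugate,
    and then \<open>x\<close>, which lies in \<open>M'\<close> but not in \<open>N\<close>, would
    belong to \<open>U M\<close>.\<close>
  have "U M \<inter> U M' = {}"
  proof (rule ccontr)
    assume "U M \<inter> U M' \<noteq> {}"
    then obtain u where u: "u \<in> U M" "u \<in> U M'" by blast
    obtain g where g: "g \<in> carrier G" "u \<in> ?c g M" using u(1) unfolding U_def by blast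
    obtain h where h: "h \<in> carrier G" "u \<in> ?c h M'" using u(2) unfolding U_def by blast
    have "u \<notin> N" using u U_sub[OF M] by blast
    from meet[OF M M'(1) g(1) h(1) this g(2) h(2)] have eq: "?c g M = ?c h M'" .
    define k where "k = inv g \<otimes> h"
    have k: "k \<in> carrier G" using g(1) h(1) by (simp add: k_def)
    have km: "k \<otimes> x \<otimes> inv k \<in> M" using conj_mem[OF M M'(1) g(1) h(1) eq M'(2)] unfolding k_def .
    have "k \<otimes> x \<otimes> inv k \<notin> N"
      using N.inv_op_closed1[OF k, of "k \<otimes> x \<otimes> inv k"] conj_inv_cancel(2)[OF k x(1)] x(2) by auto
    moreover have "x = inv k \<otimes> (k \<otimes> x \<otimes> inv k) \<otimes> inv (inv k)"
      using conj_inv_cancel(2)[OF k x(1)] k by simp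
    ultimately have "x \<in> U M" using km inv_closed[OF k] unfolding U_def by blast
    thus False using x(3) by blast
  qed
  moreover have "finite (U M)" "finite (U M')" using U_sub M M'(1) fin by (blast intro: finite_subset)+
  ultimately have "card (U M) + card (U M') = card (U M \<union> U M')" by (simp add: card_Un_disjoint)
  also have "\<dots> \<le> card (carrier G - N)" using U_sub[OF M] U_sub[OF M'(1)] fin by (intro card_mono) auto
  also have "\<dots> = card (carrier G) - card N" using finN N.subset by (simp add: card_Diff_subset)
  \<comment> \<open>Two disjoint sets of at least half the group each cannot fit into the complement
    of the nonempty \<open>N\<close>.\<close>
  finally show False using half[OF M] half[OF M'(1)] cN card_M[OF M] by linarith
qed

end

section \<open>Products, Fitting and Frattini subgroups\<close>

lemma (in group_hom) vimage_normal:
  assumes "N \<lhd> H"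
  shows "{g \<in> carrier G. h g \<in> N} \<lhd> G"
proof -
  interpret N: normal N H by fact
  have "subgroup {g \<in> carrier G. h g \<in> N} G"
  proof (rule G.subgroupI)
    have "\<one> \<in> {g \<in> carrier G. h g \<in> N}" by simp
    thus "{g \<in> carrier G. h g \<in> N} \<noteq> {}" by blast
  qed auto
  moreover have "x \<otimes> y \<otimes> inv x \<in> {g \<in> carrier G. h g \<in> N}"
    if "x \<in> carrier G" "y \<in> {g \<in> carrier G. h g \<in> N}" for x y
    using that N.inv_op_closed2[of "h x" "h y"] by simp
  ultimately show ?thesis unfolding G.normal_inv_iff by (intro conjI ballI)
qed

context group
begin

section \<open>Products of subgroups and supplements\<close>

lemma normal_in_subgroup_iff:
  assumes "subgroup L G"
  shows "K \<lhd> G\<lparr>carrier := L\<rparr> \<longleftrightarrow> subgroup K G \<and> K \<subseteq> L \<and> (\<forall>x\<in>L. \<forall>k\<in>K. x \<otimes> k \<otimes> inv x \<in> K)"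
  using m_inv_consistent[OF assms]
  by (simp add: group.normal_inv_iff[OF subgroup_imp_group[OF assms]] subgroup_sub_iff[OF assms])

text \<open>The rearrangement \<open>k \<otimes> h' = h' \<otimes> (inv h' \<otimes> k \<otimes>
  h')\<close> requires only that \<open>H\<close> normalizes \<open>K\<close>. This generality
  matters later, where neither factor is normal in the whole group.\<close>

lemma subgroup_set_mult_if_normalizes:
  assumes "subgroup H G" "subgroup K G" and nrm: "\<And>h k. h \<in> H \<Longrightarrow> k \<in> K \<Longrightarrow> h \<otimes> k \<otimes> inv h \<in> K"
  shows "subgroup (H <#> K) G"
proof (rule subgroupI)
  interpret H: subgroup H G by fact
  interpret K: subgroup K G by fact
  have "\<one> \<otimes> \<one> \<in> H <#> K" unfolding set_mult_def by (intro UN_I[OF H.one_closed] UN_I[OF K.one_closed]) simp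
  thus "H <#> K \<noteq> {}" by blast
  show "H <#> K \<subseteq> carrier G" using H.subset K.subset by (rule set_mult_closed)
  show "inv a \<in> H <#> K" if "a \<in> H <#> K" for a
  proof -
    obtain h k where hk: "h \<in> H" "k \<in> K" "a = h \<otimes> k" using \<open>a \<in> H <#> K\<close> unfolding set_mult_def by blast
    have c: "h \<in> carrier G" "k \<in> carrier G" using hk H.mem_carrier K.mem_carrier by simp_all
    have "inv a = inv h \<otimes> (h \<otimes> inv k \<otimes> inv h)"
      using c unfolding hk(3) by (simp add: inv_mult_group m_assoc inv_mult_cancel)
    moreover have "h \<otimes> inv k \<otimes> inv h \<in> K" using nrm hk(1,2) by simp
    moreover have "inv h \<in> H" using hk(1) by simp
    ultimately show ?thesis unfolding set_mult_def by blast
  qed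
  show "a \<otimes> b \<in> H <#> K" if "a \<in> H <#> K" "b \<in> H <#> K" for a b
  proof -
    obtain h k where hk: "h \<in> H" "k \<in> K" "a = h \<otimes> k" using \<open>a \<in> H <#> K\<close> unfolding set_mult_def by blast
    obtain h' k' where hk': "h' \<in> H" "k' \<in> K" "b = h' \<otimes> k'" using \<open>b \<in> H <#> K\<close> unfolding set_mult_def by blast
    have c: "h \<in> carrier G" "k \<in> carrier G" "h' \<in> carrier G" "k' \<in> carrier G"
      using hk hk' H.mem_carrier K.mem_carrier by simp_all
    have "a \<otimes> b = (h \<otimes> h') \<otimes> ((inv h' \<otimes> k \<otimes> inv (inv h')) \<otimes> k')"
      using c unfolding hk(3) hk'(3) by (simp add: m_assoc inv_mult_cancel)
    moreover have "inv h' \<otimes> k \<otimes> inv (inv h') \<in> K" using nrm[of "inv h'" k] hk(2) hk'(1) by simp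
    hence "(inv h' \<otimes> k \<otimes> inv (inv h')) \<otimes> k' \<in> K" using hk'(2) by (rule K.m_closed)
    moreover have "h \<otimes> h' \<in> H" using hk(1) hk'(1) by (rule H.m_closed)
    ultimately show ?thesis unfolding set_mult_def by blast
  qed
qed

lemma subset_set_mult:
  assumes "subgroup H G" "subgroup K G"
  shows "H \<subseteq> H <#> K" "K \<subseteq> H <#> K"
proof -
  interpret H: subgroup H G by fact
  interpret K: subgroup K G by fact
  show "H \<subseteq> H <#> K"
  proof
    fix h assume "h \<in> H"
    moreover from this have "h = h \<otimes> \<one>" by simp
    ultimately show "h \<in> H <#> K" unfolding set_mult_def using K.one_closed by blast
  qed
  show "K \<subseteq> H <#> K"
  proof
    fix k assume "k \<in> K"
    moreover from this have "k = \<one> \<otimes> k" by simp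
    ultimately show "k \<in> H <#> K" unfolding set_mult_def using H.one_closed by blast
  qed
qed

lemma normal_set_mult_normal:
  assumes "H \<lhd> G" "K \<lhd> G"
  shows "H <#> K \<lhd> G"
  unfolding normal_inv_iff
proof (intro conjI ballI)
  interpret H: normal H G by fact
  interpret K: normal K G by fact
  show "subgroup (H <#> K) G"
    by (rule subgroup_set_mult_if_normalizes[OF H.subgroup_axioms K.subgroup_axioms])
      (rule K.inv_op_closed2[OF H.mem_carrier])
  fix x a assume x: "x \<in> carrier G" and a: "a \<in> H <#> K"
  obtain h k where hk: "h \<in> H" "k \<in> K" "a = h \<otimes> k" using a unfolding set_mult_def by blast
  have "h \<in> carrier G" "k \<in> carrier G" using hk H.mem_carrier K.mem_carrier by simp_all
  hence "x \<otimes> a \<otimes> inv x = (x \<otimes> h \<otimes> inv x) \<otimes> (x \<otimes> k \<otimes> inv x)"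
    unfolding hk(3) by (rule group_hom.hom_mult[OF conj_hom[OF x]])
  thus "x \<otimes> a \<otimes> inv x \<in> H <#> K"
    using H.inv_op_closed2[OF x hk(1)] K.inv_op_closed2[OF x hk(2)] unfolding set_mult_def by blast
qed

text \<open>The quotient by \<open>N\<close> is an image of \<open>H\<close>, hence soluble, and an
  image of \<open>G\<close>, hence perfect; so it is trivial. The two derived series are compared as
  images under the projection.\<close>

lemma perfect_nilpotent_supplement:
  assumes perf: "derived G (carrier G) = carrier G" and N: "N \<lhd> G" and H: "subgroup H G"
    and nil: "nilpotent_group (G\<lparr>carrier := H\<rparr>)" and sup: "carrier G \<subseteq> N <#> H"
  shows "N = carrier G"
proof -
  interpret h: group_hom G "G Mod N" "\<lambda>a. N #> a" using N by (rule normal_group_hom_Mod)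
  interpret N: normal N G by fact
  interpret H: subgroup H G by fact
  obtain n where n: "(derived G ^^ n) H = {\<one>}" using nilpotent_subgroup_exp_derived[OF H nil] .
  have "(\<lambda>a. N #> a) ` carrier G \<subseteq> (\<lambda>a. N #> a) ` H"
  proof
    fix u assume "u \<in> (\<lambda>a. N #> a) ` carrier G"
    then obtain g where g: "g \<in> carrier G" "u = N #> g" by (rule imageE)
    have "g \<in> N <#> H" using sup g(1) by (rule subsetD)
    then obtain m k where mk: "m \<in> N" "k \<in> H" "g = m \<otimes> k" unfolding set_mult_def by blast
    have "u = (N #> m) #> k"
      unfolding g(2) mk(3) using coset_mult_assoc[OF N.subset N.mem_carrier[OF mk(1)] H.mem_carrier[OF mk(2)]] by simp
    also have "N #> m = N" using normal_coset_eq_iff[OF N N.mem_carrier[OF mk(1)]] mk(1) by simp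
    finally show "u \<in> (\<lambda>a. N #> a) ` H" using mk(2) by (rule image_eqI)
  qed
  hence eq: "(\<lambda>a. N #> a) ` H = (\<lambda>a. N #> a) ` carrier G" using image_mono[OF H.subset] by (intro equalityI)
  have "(derived G ^^ n) (carrier G) = carrier G" by (induction n) (simp_all add: perf)
  hence "(\<lambda>a. N #> a) ` carrier G = (\<lambda>a. N #> a) ` ((derived G ^^ n) (carrier G))" by simp
  also have "\<dots> = (derived (G Mod N) ^^ n) ((\<lambda>a. N #> a) ` carrier G)"
    by (rule h.exp_of_derived_img[symmetric]) simp
  also have "\<dots> = (\<lambda>a. N #> a) ` ((derived G ^^ n) H)"
    unfolding eq[symmetric] by (rule h.exp_of_derived_img[OF H.subset])
  also have "\<dots> = {N #> \<one>}" unfolding n by simp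
  finally have "g \<in> N" if "g \<in> carrier G" for g
    using normal_coset_eq_iff[OF N that] that N.subset by auto
  thus ?thesis using N.subset by (intro equalityI subsetI) auto
qed

text \<open>Zorn's lemma: were the union of a chain of proper subgroups everything, one member would
  already contain the finite set \<open>S\<close>. It is needed because without maximal subgroups
  the Frattini subgroup is the whole group by convention.\<close>

lemma finitely_generated_has_maximal_subgroup:
  assumes S: "finite S" "S \<subseteq> carrier G" "generate G S = carrier G" and nontriv: "carrier G \<noteq> {\<one>}"
  obtains M where "maximal_subgroup G M"
proof -
  let ?A = "{K. subgroup K G \<and> K \<noteq> carrier G}"
  have "\<exists>M\<in>?A. \<forall>K\<in>?A. M \<subseteq> K \<longrightarrow> K = M"
  proof (rule subset_Zorn_nonempty)
    have "{\<one>} \<in> ?A" using normal_imp_subgroup[OF one_is_normal] nontriv by simp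
    thus "?A \<noteq> {}" by blast
    fix C assume C: "C \<noteq> {}" "subset.chain ?A C"
    have sub: "subgroup K G" "K \<noteq> carrier G" if "K \<in> C" for K
      using that C(2) unfolding subset.chain_def by blast+
    have lin: "K \<subseteq> L \<or> L \<subseteq> K" if "K \<in> C" "L \<in> C" for K L
      using that C(2) unfolding subset_chain_def by blast
    have "subgroup (\<Union>C) G"
    proof (rule subgroupI)
      show "\<Union>C \<subseteq> carrier G" by (rule Union_least) (rule subgroup.subset[OF sub(1)])
      obtain K where K: "K \<in> C" using C(1) by blast
      have "\<one> \<in> \<Union>C" using K subgroup.one_closed[OF sub(1)[OF K]] by (rule UnionI)
      thus "\<Union>C \<noteq> {}" by blast
      show "inv a \<in> \<Union>C" if "a \<in> \<Union>C" for a
      proof -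
        obtain K where K: "K \<in> C" "a \<in> K" using \<open>a \<in> \<Union>C\<close> by (rule UnionE)
        show ?thesis using K(1) subgroup.m_inv_closed[OF sub(1)[OF K(1)] K(2)] by (rule UnionI)
      qed
      show "a \<otimes> b \<in> \<Union>C" if "a \<in> \<Union>C" "b \<in> \<Union>C" for a b
      proof -
        obtain K where K: "K \<in> C" "a \<in> K" using \<open>a \<in> \<Union>C\<close> by (rule UnionE)
        obtain L where L: "L \<in> C" "b \<in> L" using \<open>b \<in> \<Union>C\<close> by (rule UnionE)
        obtain M where M: "M \<in> C" "a \<in> M" "b \<in> M" using lin[OF K(1) L(1)] K L by blast
        show ?thesis using M(1) subgroup.m_closed[OF sub(1)[OF M(1)] M(2,3)] by (rule UnionI)
      qed
    qed
    moreover have "\<Union>C \<noteq> carrier G"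
    proof
      assume "\<Union>C = carrier G"
      hence "S \<subseteq> \<Union>C" using S(2) by simp
      then obtain K where K: "K \<in> C" "S \<subseteq> K" using finite_subset_Union_chain[OF S(1) _ C] by metis
      have "carrier G \<subseteq> K" using generate_subgroup_incl[OF K(2) sub(1)[OF K(1)]] S(3) by simp
      thus False using sub(2)[OF K(1)] subgroup.subset[OF sub(1)[OF K(1)]] by simp
    qed
    ultimately show "\<Union>C \<in> ?A" by simp
  qed
  then obtain M where M: "M \<in> ?A" "\<forall>K\<in>?A. M \<subseteq> K \<longrightarrow> K = M" by (rule bexE)
  have "maximal_subgroup G M" unfolding maximal_subgroup_def
  proof (intro conjI allI impI)
    show "subgroup M G" "M \<noteq> carrier G" using M(1) by simp_all
    fix K assume "subgroup K G \<and> M \<subseteq> K"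
    thus "K = M \<or> K = carrier G" using M(2) by auto
  qed
  thus ?thesis by (rule that)
qed

text \<open>Conjugation permutes the maximal subgroups, so their intersection is invariant.\<close>

lemma frattini_normal: "frattini_subgroup G \<lhd> G"
  unfolding normal_inv_iff
proof (intro conjI ballI)
  have sub: "subgroup M G" if "maximal_subgroup G M" for M using that by (simp add: maximal_subgroup_def)
  show "subgroup (frattini_subgroup G) G"
  proof (rule subgroupI)
    have "\<one> \<in> frattini_subgroup G" using sub subgroup.one_closed by (auto simp: frattini_subgroup_def)
    thus "frattini_subgroup G \<noteq> {}" by blast
  qed (auto simp: frattini_subgroup_def intro: subgroup.m_closed[OF sub] subgroup.m_inv_closed[OF sub])
  fix g x assume g: "g \<in> carrier G" and x: "x \<in> frattini_subgroup G"
  have xc: "x \<in> carrier G" using x by (simp add: frattini_subgroup_def)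
  have "g \<otimes> x \<otimes> inv g \<in> M" if M: "maximal_subgroup G M" for M
  proof -
    have "x \<in> (\<lambda>y. inv g \<otimes> y \<otimes> inv (inv g)) ` M"
      using maximal_subgroup_conj[OF M inv_closed[OF g]] x unfolding frattini_subgroup_def by blast
    then obtain y where y: "x = inv g \<otimes> y \<otimes> inv (inv g)" "y \<in> M" by (rule imageE)
    have "y \<in> carrier G" using y(2) by (rule subgroup.mem_carrier[OF sub[OF M]])
    hence "g \<otimes> x \<otimes> inv g = y" using conj_inv_cancel(1)[OF g] g unfolding y(1) by simp
    thus ?thesis using y(2) by simp
  qed
  thus "g \<otimes> x \<otimes> inv g \<in> frattini_subgroup G" using g xc by (simp add: frattini_subgroup_def)
qed

end

text \<open>Isolates the properties of \<Gamma> that determine its Fitting and Frattini subgroups.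
  It is instantiated with \<Gamma> as a group in its own right, so that normality below means
  normality in \<Gamma>.\<close>

locale perfect_with_nilpotent_normal_subgroups = group +
  fixes S
  assumes perfect: "derived G (carrier G) = carrier G"
    and nontrivial: "carrier G \<noteq> {\<one>}"
    and normal_nilpotent: "\<And>K. K \<lhd> G \<Longrightarrow> K \<noteq> carrier G \<Longrightarrow> nilpotent_group (G\<lparr>carrier := K\<rparr>)"
    and generators: "finite S" "S \<subseteq> carrier G" "generate G S = carrier G"
begin

lemma proper_normal_supplement:
  assumes "K \<lhd> G" "K \<noteq> carrier G" "subgroup H G" "nilpotent_group (G\<lparr>carrier := H\<rparr>)"
  shows "\<not> carrier G \<subseteq> K <#> H"
  using perfect_nilpotent_supplement[OF perfect assms(1,3,4)] assms(2) by blast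

text \<open>A nilpotent group would be a nilpotent supplement to its own trivial subgroup.\<close>

lemma not_nilpotent: "\<not> nilpotent_group G"
proof
  assume "nilpotent_group G"
  hence nil: "nilpotent_group (G\<lparr>carrier := carrier G\<rparr>)" by simp
  have "carrier G \<subseteq> {\<one>} <#> carrier G" using subset_set_mult(2)[OF triv_subgroup subgroup_self] .
  thus False using proper_normal_supplement[OF one_is_normal _ subgroup_self nil] nontrivial by blast
qed

lemma proper_normal_set_mult:
  assumes "K \<lhd> G" "K \<noteq> carrier G" "L \<lhd> G" "L \<noteq> carrier G"
  shows "K <#> L \<lhd> G" "K <#> L \<noteq> carrier G"
  using normal_set_mult_normal[OF assms(1,3)]
    proper_normal_supplement[OF assms(1,2) normal_imp_subgroup[OF assms(3)] normal_nilpotent[OF assms(3,4)]]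
  by auto

text \<open>Proper normal subgroups form a directed family, since the product of two of them is
  again proper; elements are absorbed one at a time.\<close>

lemma finite_subset_proper_normal:
  assumes "finite F" "F \<subseteq> \<Union>{K. K \<lhd> G \<and> K \<noteq> carrier G}"
  shows "\<exists>K. K \<lhd> G \<and> K \<noteq> carrier G \<and> F \<subseteq> K"
  using assms
proof (induction F rule: finite_induct)
  case empty
  show ?case using one_is_normal nontrivial by blast
next
  case (insert x F)
  then obtain K where K: "K \<lhd> G" "K \<noteq> carrier G" "F \<subseteq> K" by auto
  obtain L where L: "L \<lhd> G" "L \<noteq> carrier G" "x \<in> L" using insert.prems by auto
  have "insert x F \<subseteq> K <#> L"
    using subset_set_mult[OF normal_imp_subgroup[OF K(1)] normal_imp_subgroup[OF L(1)]] K(3) L(3) by auto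
  thus ?case using proper_normal_set_mult[OF K(1,2) L(1,2)] by (intro exI[of _ "K <#> L"]) simp
qed

lemma Union_proper_normal:
  defines "U \<equiv> \<Union>{K. K \<lhd> G \<and> K \<noteq> carrier G}"
  shows "U \<lhd> G" "U \<noteq> carrier G"
proof -
  have in_U: "x \<in> U" if "K \<lhd> G" "K \<noteq> carrier G" "x \<in> K" for x K using that unfolding U_def by blast
  have sub: "U \<subseteq> carrier G" unfolding U_def
    by (rule Union_least) (elim CollectE conjE, rule subgroup.subset[OF normal_imp_subgroup])
  \<comment> \<open>Each closure property concerns at most two elements, and properness concerns the
    finite set \<open>S\<close>, so everything can be checked inside a single member of the
    family.\<close>
  have fin: "\<exists>K. K \<lhd> G \<and> K \<noteq> carrier G \<and> F \<subseteq> K" if "finite F" "F \<subseteq> U" for F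
    using finite_subset_proper_normal[OF that(1)] that(2) unfolding U_def .
  show "U \<lhd> G" unfolding normal_inv_iff
  proof (intro conjI ballI)
    show "subgroup U G"
    proof (rule subgroupI[OF sub])
      have "\<one> \<in> U" using in_U[OF one_is_normal] nontrivial by auto
      thus "U \<noteq> {}" by blast
      show "inv a \<in> U" if a: "a \<in> U" for a
      proof -
        obtain K where K: "K \<lhd> G" "K \<noteq> carrier G" "a \<in> K" using fin[of "{a}"] a by auto
        show ?thesis using in_U[OF K(1,2)] subgroup.m_inv_closed[OF normal_imp_subgroup[OF K(1)] K(3)] by simp
      qed
      show "a \<otimes> b \<in> U" if ab: "a \<in> U" "b \<in> U" for a b
      proof -
        obtain K where K: "K \<lhd> G" "K \<noteq> carrier G" "a \<in> K" "b \<in> K" using fin[of "{a, b}"] ab by auto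
        show ?thesis using in_U[OF K(1,2)] subgroup.m_closed[OF normal_imp_subgroup[OF K(1)] K(3,4)] by simp
      qed
    qed
    fix x a assume x: "x \<in> carrier G" and a: "a \<in> U"
    obtain K where K: "K \<lhd> G" "K \<noteq> carrier G" "a \<in> K" using fin[of "{a}"] a by auto
    show "x \<otimes> a \<otimes> inv x \<in> U" using in_U[OF K(1,2)] normal.inv_op_closed2[OF K(1) x K(3)] by simp
  qed
  show "U \<noteq> carrier G"
  proof
    assume "U = carrier G"
    then obtain K where K: "K \<lhd> G" "K \<noteq> carrier G" "S \<subseteq> K" using fin[OF generators(1)] generators(2) by auto
    have "carrier G \<subseteq> K"
      using generate_subgroup_incl[OF K(3) normal_imp_subgroup[OF K(1)]] generators(3) by simp
    thus False using K(2) subgroup.subset[OF normal_imp_subgroup[OF K(1)]] by simp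
  qed
qed

text \<open>Here the nilpotent normal subgroups are exactly the proper normal ones, and their union
  is already a subgroup, so generating adds nothing.\<close>

lemma fitting_eq: "fitting_subgroup G = \<Union>{K. K \<lhd> G \<and> K \<noteq> carrier G}"
proof -
  let ?U = "\<Union>{K. K \<lhd> G \<and> K \<noteq> carrier G}"
  have eq: "{x. \<exists>N. N \<lhd> G \<and> nilpotent_group (G\<lparr>carrier := N\<rparr>) \<and> x \<in> N} = ?U"
    using normal_nilpotent not_nilpotent by auto
  show ?thesis unfolding fitting_subgroup_def eq
  proof
    show "generate G ?U \<subseteq> ?U"
      by (rule generate_subgroup_incl[OF subset_refl normal_imp_subgroup[OF Union_proper_normal(1)]])
    show "?U \<subseteq> generate G ?U" by (rule subsetI) (rule generate.incl)
  qed
qed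

lemmas fitting_normal = Union_proper_normal(1)[folded fitting_eq]
  and fitting_proper = Union_proper_normal(2)[folded fitting_eq]

lemma proper_normal_subset_fitting:
  assumes "K \<lhd> G" "K \<noteq> carrier G" shows "K \<subseteq> fitting_subgroup G"
  unfolding fitting_eq using assms by (intro Union_upper) simp

lemma Mod_fitting_not_comm: "\<not> comm_group (G Mod fitting_subgroup G)"
proof
  assume "comm_group (G Mod fitting_subgroup G)"
  from derived_minimal[OF fitting_normal this] show False
    using perfect fitting_proper subgroup.subset[OF normal_imp_subgroup[OF fitting_normal]] by simp
qed

text \<open>The Fitting subgroup is the largest proper normal subgroup, so the preimage of a normal
  subgroup of the quotient is either everything or contained in it.\<close>

lemma Mod_fitting_simple: "is_simple_group (G Mod fitting_subgroup G)"
proof -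
  let ?F = "fitting_subgroup G"
  interpret h: group_hom G "G Mod ?F" "\<lambda>a. ?F #> a" using fitting_normal by (rule normal_group_hom_Mod)
  have surj: "(\<lambda>a. ?F #> a) ` carrier G = carrier (G Mod ?F)"
    by (auto simp: FactGroup_def RCOSETS_def)
  have one: "\<one>\<^bsub>G Mod ?F\<^esub> = ?F" by simp
  have "carrier (G Mod ?F) \<noteq> {?F}"
  proof
    assume eq: "carrier (G Mod ?F) = {?F}"
    have "carrier G \<subseteq> ?F"
    proof
      fix g assume g: "g \<in> carrier G"
      hence "?F #> g = ?F" using h.hom_closed[OF g] unfolding eq by simp
      thus "g \<in> ?F" using normal_coset_eq_iff[OF fitting_normal g] by simp
    qed
    thus False using fitting_proper subgroup.subset[OF normal_imp_subgroup[OF fitting_normal]] by simp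
  qed
  moreover have "N = carrier (G Mod ?F) \<or> N = {?F}" if N: "N \<lhd> G Mod ?F" for N
  proof -
    let ?K = "{g \<in> carrier G. ?F #> g \<in> N}"
    interpret N: normal N "G Mod ?F" by fact
    have K: "?K \<lhd> G" using N by (rule h.vimage_normal)
    have img: "\<exists>g\<in>?K. c = ?F #> g" if c: "c \<in> N" for c
    proof -
      have "c \<in> (\<lambda>a. ?F #> a) ` carrier G" unfolding surj using c by (rule N.mem_carrier)
      then obtain g where "c = ?F #> g" "g \<in> carrier G" by (rule imageE)
      thus ?thesis using c by (intro bexI[of _ g]) simp_all
    qed
    show ?thesis
    proof (cases "?K = carrier G")
      case True
      have "carrier (G Mod ?F) \<subseteq> N"
      proof
        fix c assume "c \<in> carrier (G Mod ?F)"
        then obtain g where g: "c = ?F #> g" "g \<in> carrier G" unfolding surj[symmetric] by (rule imageE)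
        have "g \<in> ?K" unfolding True by (rule g(2))
        thus "c \<in> N" unfolding g(1) by simp
      qed
      thus ?thesis using N.subset by (intro disjI1 equalityI)
    next
      case False
      have KF: "?K \<subseteq> ?F" using K False by (rule proper_normal_subset_fitting)
      have "N \<subseteq> {?F}"
      proof
        fix c assume "c \<in> N"
        then obtain g where g: "g \<in> ?K" "c = ?F #> g" using img by (elim bexE[OF img])
        have "?F #> g = ?F" using normal_coset_eq_iff[OF fitting_normal] g(1) KF by auto
        thus "c \<in> {?F}" using g(2) by simp
      qed
      thus ?thesis using N.one_closed one by auto
    qed
  qed
  ultimately show ?thesis unfolding is_simple_group_def one using h.H.is_group by simp
qed

text \<open>The Frattini subgroup is normal, and proper since a maximal subgroup exists, so it lies
  in the Fitting subgroup. Conversely, a maximal subgroup missing part of the Fitting subgroup would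
  be a nilpotent supplement to it.\<close>

lemma fitting_eq_frattini:
  assumes "\<And>H. subgroup H G \<Longrightarrow> H \<noteq> carrier G \<Longrightarrow> nilpotent_group (G\<lparr>carrier := H\<rparr>)"
  shows "fitting_subgroup G = frattini_subgroup G"
proof
  obtain M0 where M0: "maximal_subgroup G M0"
    using finitely_generated_has_maximal_subgroup[OF generators nontrivial] .
  have "frattini_subgroup G \<subseteq> M0" using M0 unfolding frattini_subgroup_def by auto
  hence "frattini_subgroup G \<noteq> carrier G"
    using M0 subgroup.subset[of M0 G] unfolding maximal_subgroup_def by auto
  thus "frattini_subgroup G \<subseteq> fitting_subgroup G" by (rule proper_normal_subset_fitting[OF frattini_normal])
  let ?F = "fitting_subgroup G"
  interpret F: normal ?F G by (rule fitting_normal)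
  have "?F \<subseteq> M" if M: "maximal_subgroup G M" for M
  proof (rule ccontr)
    assume nsub: "\<not> ?F \<subseteq> M"
    have Msub: "subgroup M G" "M \<noteq> carrier G" using M by (simp_all add: maximal_subgroup_def)
    have "subgroup (?F <#> M) G" using fitting_normal Msub(1) mult_norm_subgroup by blast
    moreover have "M \<subseteq> ?F <#> M" "?F \<subseteq> ?F <#> M" by (rule subset_set_mult[OF F.subgroup_axioms Msub(1)])+
    ultimately have "?F <#> M = carrier G" using M nsub unfolding maximal_subgroup_def by metis
    thus False
      using proper_normal_supplement[OF fitting_normal fitting_proper Msub(1) assms[OF Msub]] by simp
  qed
  thus "?F \<subseteq> frattini_subgroup G" unfolding frattini_subgroup_def using F.subset by auto
qed

end

section \<open>Insoluble para-nilpotent-Hamiltonian groups\<close>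

context group
begin

section \<open>Normal closures and centralizing elements\<close>

lemma finite_set_mult:
  assumes "finite A" "finite B" shows "finite (A <#> B)"
  unfolding set_mult_def using assms by simp

lemma normal_closure_conj:
  assumes "g \<in> carrier G" "x \<in> A" "A \<subseteq> carrier G"
  shows "g \<otimes> x \<otimes> inv g \<in> normal_closure G A"
proof -
  have "g \<otimes> x \<otimes> inv g \<in> N" if "N \<lhd> G \<and> A \<subseteq> N" for N
  proof -
    have "x \<in> N" using that assms(2) by auto
    thus ?thesis using that assms(1) by (intro normal.inv_op_closed2) auto
  qed
  moreover have "g \<otimes> x \<otimes> inv g \<in> carrier G" using assms by (intro m_closed inv_closed) auto
  ultimately show ?thesis unfolding normal_closure_def by simp
qed

lemma normal_closure_subset:
  assumes "N \<lhd> G" "A \<subseteq> N" shows "normal_closure G A \<subseteq> N"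
  using assms unfolding normal_closure_def by auto

text \<open>Conjugation on \<open>Y\<close> gives only finitely many functions from \<open>Y\<close>
  to \<open>C\<close>, so infinitely many \<open>g\<close> act like one fixed \<open>a\<close>. All
  \<open>inv a \<otimes> g\<close> centralize \<open>Y\<close>, and being infinitely many they do
  not all lie in \<open>Y\<close>.\<close>

lemma centralizing_element_outside:
  assumes inf: "infinite (carrier G)" and Y: "Y \<subseteq> carrier G" "finite Y"
    and C: "finite C" "\<And>g y. g \<in> carrier G \<Longrightarrow> y \<in> Y \<Longrightarrow> g \<otimes> y \<otimes> inv g \<in> C"
  obtains c where "c \<in> carrier G" "c \<notin> Y" "\<And>y. y \<in> Y \<Longrightarrow> c \<otimes> y \<otimes> inv c = y"
proof -
  let ?f = "\<lambda>g. \<lambda>y\<in>Y. g \<otimes> y \<otimes> inv g"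
  have "?f ` carrier G \<subseteq> Y \<rightarrow>\<^sub>E C" using C(2) by auto
  hence "finite (?f ` carrier G)" by (rule finite_subset) (use Y(2) C(1) in \<open>simp add: finite_PiE\<close>)
  from pigeonhole_infinite[OF inf this] obtain a
    where a: "a \<in> carrier G" "infinite {g \<in> carrier G. ?f g = ?f a}" by (rule bexE)
  have "inj_on (\<lambda>g. inv a \<otimes> g) {g \<in> carrier G. ?f g = ?f a}" using a(1) by (intro inj_onI) simp
  hence "infinite ((\<lambda>g. inv a \<otimes> g) ` {g \<in> carrier G. ?f g = ?f a})" using a(2) finite_imageD by blast
  hence "\<not> (\<lambda>g. inv a \<otimes> g) ` {g \<in> carrier G. ?f g = ?f a} \<subseteq> Y" using Y(2) finite_subset by blast
  then obtain g where g: "g \<in> carrier G" "?f g = ?f a" "inv a \<otimes> g \<notin> Y" by blast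
  show ?thesis
  proof (rule that)
    show "inv a \<otimes> g \<in> carrier G" "inv a \<otimes> g \<notin> Y" using a(1) g(1,3) by simp_all
    fix y assume y: "y \<in> Y"
    have yc: "y \<in> carrier G" using Y(1) y by (rule subsetD)
    have "g \<otimes> y \<otimes> inv g = a \<otimes> y \<otimes> inv a" using fun_cong[OF g(2), of y] y by simp
    thus "inv a \<otimes> g \<otimes> y \<otimes> inv (inv a \<otimes> g) = y"
      using conj_mult[OF inv_closed[OF a(1)] g(1) yc] conj_inv_cancel(2)[OF a(1) yc] a(1) by simp
  qed
qed

end

locale insoluble_para_nil_hamiltonian = group +
  assumes para: "para_nil_hamiltonian G"
    and insoluble: "\<not> solvable G"
begin

abbreviation "\<Gamma> \<equiv> lcs G 3"

section \<open>The subgroup \<Gamma>\<close>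

lemma minimal_if_not_normal:
  assumes "subgroup H G" "\<not> nilpotent_group (G\<lparr>carrier := H\<rparr>)" "\<not> H \<lhd> G"
  shows "minimal_non_nilpotent (G\<lparr>carrier := H\<rparr>)"
  using para assms unfolding para_nil_hamiltonian_def by blast

text \<open>A non-normal \<open>K\<close> would be minimal non-nilpotent, which leaves no room for
  the non-nilpotent proper subgroup \<open>H\<close>.\<close>

lemma normal_if_above_non_nilpotent:
  assumes "subgroup H G" "\<not> nilpotent_group (G\<lparr>carrier := H\<rparr>)" "subgroup K G" "H \<subset> K"
  shows "K \<lhd> G"
proof (rule ccontr)
  assume "\<not> K \<lhd> G"
  hence "minimal_non_nilpotent (G\<lparr>carrier := K\<rparr>)"
    using minimal_if_not_normal[OF assms(3)] subgroup_not_nilpotent_mono[OF assms(1-3)] assms(4) by blast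
  thus False using minimal_non_nilpotent_subgroup[OF assms(3) _ assms(1,4)] assms(2) by blast
qed

lemma Gamma_least:
  assumes "M \<lhd> G" "\<not> nilpotent_group (G\<lparr>carrier := M\<rparr>)"
  shows "\<Gamma> \<subseteq> M"
proof (rule lcs_3_subset_if_overgroups_normal[OF assms(1)])
  fix H assume H: "subgroup H G" "M \<subseteq> H"
  show "H \<lhd> G"
  proof (cases "M = H")
    case False
    show ?thesis
      by (rule normal_if_above_non_nilpotent[OF normal_imp_subgroup[OF assms(1)] assms(2) H(1)])
        (use H(2) False in auto)
  qed (use assms(1) in simp)
qed

lemma Gamma_normal: "\<Gamma> \<lhd> G"
  by (rule lcs_normal)

lemma Gamma_subgroup: "subgroup \<Gamma> G"
  using Gamma_normal by (rule normal_imp_subgroup)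

lemma Gamma_subset_above:
  assumes "subgroup H G" "\<not> nilpotent_group (G\<lparr>carrier := H\<rparr>)" "subgroup K G" "H \<subset> K"
  shows "\<Gamma> \<subseteq> K"
proof -
  have "H \<subseteq> K" using assms(4) by auto
  show ?thesis
    using normal_if_above_non_nilpotent[OF assms] subgroup_not_nilpotent_mono[OF assms(1-3) \<open>H \<subseteq> K\<close>]
    by (rule Gamma_least)
qed

text \<open>The second derived subgroup of \<open>G\<close> lies in \<Gamma>, so a derived series of
  \<Gamma> reaching the identity after \<open>n\<close> steps would end that of \<open>G\<close>
  after \<open>n + 2\<close>.\<close>

lemma exp_derived_Gamma_nontrivial: "(derived G ^^ n) \<Gamma> \<noteq> {\<one>}"
proof
  assume triv: "(derived G ^^ n) \<Gamma> = {\<one>}"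
  have l2: "derived G (carrier G) = lcs G 2" unfolding lcs_2 derived_eq_comm_subgroup ..
  have "derived G (lcs G 2) \<subseteq> \<Gamma>"
    unfolding lcs_3 derived_eq_comm_subgroup
    by (rule comm_subgroup_mono[OF subset_refl subgroup.subset[OF normal_imp_subgroup[OF lcs_normal]]])
  hence "(derived G ^^ n) (derived G (derived G (carrier G))) \<subseteq> {\<one>}"
    using mono_exp_of_derived[of "derived G (lcs G 2)" \<Gamma> n] unfolding l2 triv by simp
  moreover have "(derived G ^^ n) (derived G (derived G (carrier G))) = (derived G ^^ Suc (Suc n)) (carrier G)"
    by (simp only: funpow_Suc_right comp_apply)
  moreover have "\<one> \<in> (derived G ^^ Suc (Suc n)) (carrier G)"
    by (rule subgroup.one_closed[OF exp_of_derived_is_subgroup[OF subgroup_self]])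
  ultimately have "(derived G ^^ Suc (Suc n)) (carrier G) = {\<one>}" by (metis subset_singletonD empty_iff)
  thus False using insoluble solvable_iff_trivial_derived_seq by (metis)
qed

lemma Gamma_not_nilpotent: "\<not> nilpotent_group (G\<lparr>carrier := \<Gamma>\<rparr>)"
  using nilpotent_subgroup_exp_derived[OF Gamma_subgroup] exp_derived_Gamma_nontrivial by metis

lemma Gamma_perfect: "derived G \<Gamma> = \<Gamma>"
proof
  show "derived G \<Gamma> \<subseteq> \<Gamma>" using derived_incl[OF subset_refl Gamma_subgroup] .
  have sub: "subgroup (derived G \<Gamma>) G" using subgroup.subset[OF Gamma_subgroup] by (rule derived_is_subgroup)
  have "\<not> nilpotent_group (G\<lparr>carrier := derived G \<Gamma>\<rparr>)"
  proof
    assume nil: "nilpotent_group (G\<lparr>carrier := derived G \<Gamma>\<rparr>)"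
    obtain n where n: "(derived G ^^ n) (derived G \<Gamma>) = {\<one>}" using nilpotent_subgroup_exp_derived[OF sub nil] .
    have "(derived G ^^ Suc n) \<Gamma> = {\<one>}" unfolding funpow_Suc_right comp_apply by (rule n)
    thus False using exp_derived_Gamma_nontrivial by (rule notE[rotated])
  qed
  thus "\<Gamma> \<subseteq> derived G \<Gamma>" by (rule Gamma_least[OF derived_is_normal[OF Gamma_normal]])
qed

lemma Gamma_insoluble: "\<not> solvable (G\<lparr>carrier := \<Gamma>\<rparr>)"
proof -
  interpret \<Gamma>: group "G\<lparr>carrier := \<Gamma>\<rparr>" using Gamma_subgroup by (rule subgroup_imp_group)
  show ?thesis
    using exp_derived_Gamma_nontrivial
    by (simp add: \<Gamma>.solvable_iff_trivial_derived_seq exp_derived_consistent[OF Gamma_subgroup])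
qed

text \<open>Perfectness keeps \<Gamma> inside every term: if \<Gamma> lies in one term, its
  commutators with itself, which generate \<Gamma>, lie in the next.\<close>

lemma Gamma_eq_lcs_infty: "\<Gamma> = lcs_infty G"
proof
  have "\<Gamma> \<subseteq> lcs G (Suc n)" for n
  proof (induction n)
    case 0
    show ?case using subgroup.subset[OF Gamma_subgroup] by simp
  next
    case (Suc n)
    have "comm_subgroup G \<Gamma> \<Gamma> \<subseteq> comm_subgroup G (lcs G (Suc n)) (carrier G)"
      using Suc subgroup.subset[OF Gamma_subgroup] by (rule comm_subgroup_mono)
    thus ?case using Gamma_perfect unfolding derived_eq_comm_subgroup by simp
  qed
  hence "\<Gamma> \<subseteq> lcs G i" if "i \<in> {1..}" for i using that by (cases i) simp_all
  thus "\<Gamma> \<subseteq> lcs_infty G" unfolding lcs_infty_def by (rule INT_greatest)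
  show "lcs_infty G \<subseteq> \<Gamma>" unfolding lcs_infty_def by (rule INT_lower) simp
qed

text \<open>\<open>K\<close> is normal only in \<Gamma>, so the leastness of \<Gamma> does not apply
  to it. It applies to the span of \<open>K\<close> and one further element \<open>y\<close>, which
  therefore is \<Gamma>, and \<Gamma> modulo \<open>K\<close> becomes cyclic.\<close>

lemma proper_normal_of_Gamma_nilpotent:
  assumes K: "K \<lhd> G\<lparr>carrier := \<Gamma>\<rparr>" "K \<noteq> \<Gamma>"
  shows "nilpotent_group (G\<lparr>carrier := K\<rparr>)"
proof (rule ccontr)
  assume nn: "\<not> nilpotent_group (G\<lparr>carrier := K\<rparr>)"
  interpret \<Gamma>: group "G\<lparr>carrier := \<Gamma>\<rparr>" using Gamma_subgroup by (rule subgroup_imp_group)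
  have Ksub: "subgroup K G" "K \<subseteq> \<Gamma>" using K(1) unfolding normal_in_subgroup_iff[OF Gamma_subgroup] by simp_all
  obtain y where y: "y \<in> \<Gamma>" "y \<notin> K" using K(2) Ksub(2) by auto
  let ?L = "generate G (insert y K)"
  have ins: "insert y K \<subseteq> \<Gamma>" using y(1) Ksub(2) by simp
  have "insert y K \<subseteq> carrier G" using ins subgroup.subset[OF Gamma_subgroup] by (rule subset_trans)
  hence L: "subgroup ?L G" by (rule generate_is_subgroup)
  have incl: "insert y K \<subseteq> ?L" by (rule subsetI) (rule generate.incl)
  hence "K \<subset> ?L" using y(2) by auto
  hence "\<Gamma> \<subseteq> ?L" by (rule Gamma_subset_above[OF Ksub(1) nn L])
  moreover have "?L \<subseteq> \<Gamma>" using ins Gamma_subgroup by (rule generate_subgroup_incl)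
  ultimately have "generate (G\<lparr>carrier := \<Gamma>\<rparr>) (insert y K) = carrier (G\<lparr>carrier := \<Gamma>\<rparr>)"
    using generate_consistent[OF ins Gamma_subgroup] by simp
  from \<Gamma>.derived_subset_if_cyclic_Mod[OF K(1) _ this] have "derived G \<Gamma> \<subseteq> K"
    using y(1) derived_consistent[OF subset_refl Gamma_subgroup] by simp
  thus False using Gamma_perfect Ksub(2) K(2) by simp
qed

text \<open>For \<open>y \<in> \<Gamma> - H\<close> the conjugates of \<open>y\<close> under \<open>H\<close> generate a subgroup \<open>D\<close> normalized by \<open>H\<close>, and
  \<open>H D\<close> contains \<open>\<Gamma>\<close>; by Dedekind's modular law \<open>\<Gamma> = (H \<inter> \<Gamma>) D\<close>.\<close>

lemma Gamma_finitely_generated: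
  assumes H: "subgroup H G" "finite H" "\<not> nilpotent_group (G\<lparr>carrier := H\<rparr>)" "\<not> H \<lhd> G"
  obtains S where "finite S" "S \<subseteq> \<Gamma>" "generate G S = \<Gamma>"
proof -
  interpret H: subgroup H G by fact
  interpret \<Gamma>: normal \<Gamma> G by (rule Gamma_normal)
  have mnn: "minimal_non_nilpotent (G\<lparr>carrier := H\<rparr>)" using H(1,3,4) by (rule minimal_if_not_normal)
  \<comment> \<open>A proper inclusion contradicts minimality of \<open>H\<close>, because \<Gamma>
    is not nilpotent; equality contradicts that \<open>H\<close> is not normal.\<close>
  have "\<not> \<Gamma> \<subseteq> H"
  proof
    assume "\<Gamma> \<subseteq> H"
    moreover have "\<not> \<Gamma> \<subset> H"
      using minimal_non_nilpotent_subgroup[OF H(1) mnn Gamma_subgroup] Gamma_not_nilpotent by auto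
    ultimately have "\<Gamma> = H" by auto
    thus False using Gamma_normal H(4) by simp
  qed
  then obtain y where y: "y \<in> \<Gamma>" "y \<notin> H" by auto
  have yc: "y \<in> carrier G" using y(1) by (rule \<Gamma>.mem_carrier)
  let ?T = "(\<lambda>h. h \<otimes> y \<otimes> inv h) ` H"
  let ?D = "generate G ?T"
  have T\<Gamma>: "?T \<subseteq> \<Gamma>" using \<Gamma>.inv_op_closed2[OF H.mem_carrier y(1)] by (rule image_subsetI)
  have Tc: "?T \<subseteq> carrier G" using T\<Gamma> \<Gamma>.subset by (rule subset_trans)
  have D: "subgroup ?D G" using Tc by (rule generate_is_subgroup)
  have D\<Gamma>: "?D \<subseteq> \<Gamma>" using T\<Gamma> Gamma_subgroup by (rule generate_subgroup_incl)
  have nrm: "h \<otimes> d \<otimes> inv h \<in> ?D" if h: "h \<in> H" and d: "d \<in> ?D" for h d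
  proof -
    have hc: "h \<in> carrier G" using h by (rule H.mem_carrier)
    interpret c: group_hom G G "\<lambda>z. h \<otimes> z \<otimes> inv h" using hc by (rule conj_hom)
    \<comment> \<open>Conjugation by \<open>h\<close> sends the generator indexed by
      \<open>k\<close> to the one indexed by \<open>h \<otimes> k\<close>.\<close>
    have "(\<lambda>z. h \<otimes> z \<otimes> inv h) ` ?T \<subseteq> ?T"
    proof
      fix t assume "t \<in> (\<lambda>z. h \<otimes> z \<otimes> inv h) ` ?T"
      then obtain k where k: "k \<in> H" "t = h \<otimes> (k \<otimes> y \<otimes> inv k) \<otimes> inv h" by auto
      have "t = (h \<otimes> k) \<otimes> y \<otimes> inv (h \<otimes> k)"
        unfolding k(2) by (rule conj_mult[OF hc H.mem_carrier[OF k(1)] yc, symmetric])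
      thus "t \<in> ?T" using H.m_closed[OF h k(1)] by (rule image_eqI)
    qed
    hence "generate G ((\<lambda>z. h \<otimes> z \<otimes> inv h) ` ?T) \<subseteq> ?D" by (rule mono_generate)
    hence "(\<lambda>z. h \<otimes> z \<otimes> inv h) ` ?D \<subseteq> ?D" unfolding c.generate_img[OF Tc] .
    thus ?thesis using d by (rule image_subset_iff[THEN iffD1, rule_format])
  qed
  have HD: "subgroup (H <#> ?D) G" using H(1) D nrm by (rule subgroup_set_mult_if_normalizes)
  have "\<one> \<otimes> y \<otimes> inv \<one> \<in> ?T" using H.one_closed by (rule imageI)
  hence "y \<in> ?D" using yc by (intro generate.incl) simp
  hence "H \<subset> H <#> ?D" using subset_set_mult[OF H(1) D] y(2) by auto
  hence \<Gamma>HD: "\<Gamma> \<subseteq> H <#> ?D" by (rule Gamma_subset_above[OF H(1,3) HD])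
  let ?S = "(H \<inter> \<Gamma>) \<union> ?T"
  have Sc: "?S \<subseteq> carrier G" using Tc H.subset by auto
  have S: "subgroup (generate G ?S) G" using Sc by (rule generate_is_subgroup)
  show ?thesis
  proof (rule that)
    show "finite ?S" using H(2) by simp
    show S\<Gamma>: "?S \<subseteq> \<Gamma>" using T\<Gamma> by auto
    show "generate G ?S = \<Gamma>"
    proof
      show "generate G ?S \<subseteq> \<Gamma>" using S\<Gamma> Gamma_subgroup by (rule generate_subgroup_incl)
      show "\<Gamma> \<subseteq> generate G ?S"
      proof
        fix g assume g: "g \<in> \<Gamma>"
        have "g \<in> H <#> ?D" using \<Gamma>HD g by (rule subsetD)
        then obtain h d where hd: "h \<in> H" "d \<in> ?D" "g = h \<otimes> d" unfolding set_mult_def by auto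
        have dc: "d \<in> carrier G" using hd(2) by (rule subgroup.mem_carrier[OF D])
        have d\<Gamma>: "d \<in> \<Gamma>" using D\<Gamma> hd(2) by (rule subsetD)
        \<comment> \<open>The modular law: both \<open>g\<close> and \<open>d\<close> lie in
          \<Gamma>, so the factor \<open>h\<close> does too.\<close>
        have "h = g \<otimes> inv d" using hd(1,3) dc by (simp add: m_assoc H.mem_carrier)
        hence "h \<in> \<Gamma>" using \<Gamma>.m_closed[OF g \<Gamma>.m_inv_closed[OF d\<Gamma>]] by simp
        hence "h \<in> generate G ?S" using hd(1) by (intro generate.incl) simp
        moreover have "d \<in> generate G ?S" using hd(2) mono_generate[of ?T ?S] by auto
        ultimately show "g \<in> generate G ?S" unfolding hd(3) by (rule subgroup.m_closed[OF S])
      qed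
    qed
  qed
qed

section \<open>Finiteness from the normal closure\<close>

lemma finite_if_normal_closure_finite:
  assumes H: "subgroup H G" "finite H" "\<not> nilpotent_group (G\<lparr>carrier := H\<rparr>)" and cl: "finite (normal_closure G H)"
  shows "finite (carrier G)"
proof (rule ccontr)
  assume inf: "infinite (carrier G)"
  \<comment> \<open>A minimal member \<open>Y\<close> serves twice: it has no room for a smaller
    \<Gamma>, and, once equal to \<Gamma>, it has no non-nilpotent proper subgroup.\<close>
  let ?A = "{Y. subgroup Y G \<and> Y \<subseteq> H \<and> \<not> nilpotent_group (G\<lparr>carrier := Y\<rparr>)}"
  have "?A \<subseteq> Pow H" by auto
  hence finA: "finite ?A" by (rule finite_subset) (use H(2) in simp)
  have "H \<in> ?A" using H(1,3) by simp
  hence "?A \<noteq> {}" by auto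
  from finite_has_minimal[OF finA this] obtain Y where Y: "Y \<in> ?A" "\<forall>Z\<in>?A. Z \<subseteq> Y \<longrightarrow> Y = Z" by (rule bexE)
  have Ysub: "subgroup Y G" "Y \<subseteq> H" "\<not> nilpotent_group (G\<lparr>carrier := Y\<rparr>)" using Y(1) by simp_all
  have Ymin: "Z = Y" if "subgroup Z G" "Z \<subseteq> Y" "\<not> nilpotent_group (G\<lparr>carrier := Z\<rparr>)" for Z
    using Y(2) that Ysub(2) by auto
  interpret Y: subgroup Y G by fact
  have finY: "finite Y" using Ysub(2) H(2) by (rule finite_subset)
  have conj: "g \<otimes> y \<otimes> inv g \<in> normal_closure G H" if "g \<in> carrier G" "y \<in> Y" for g y
    using that Ysub(2) subgroup.subset[OF H(1)] by (intro normal_closure_conj) auto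
  obtain c where c: "c \<in> carrier G" "c \<notin> Y" "\<And>y. y \<in> Y \<Longrightarrow> c \<otimes> y \<otimes> inv c = y"
    using centralizing_element_outside[OF inf Y.subset finY cl conj] by metis
  let ?L = "generate G (insert c Y)"
  have ins: "insert c Y \<subseteq> carrier G" using c(1) Y.subset by simp
  have L: "subgroup ?L G" using ins by (rule generate_is_subgroup)
  have incl: "insert c Y \<subseteq> ?L" by (rule subsetI) (rule generate.incl)
  have "c \<in> conj_stabilizer G Y"
  proof (rule conj_stabilizerI[OF c(1)])
    fix y assume y: "y \<in> Y"
    show "c \<otimes> y \<otimes> inv c \<in> Y" using c(3)[OF y] y by simp
    show "inv c \<otimes> y \<otimes> c \<in> Y" using conj_inv_cancel(2)[OF c(1) Y.mem_carrier[OF y]] c(3)[OF y] y by simp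
  qed
  hence "insert c Y \<subseteq> conj_stabilizer G Y" using subset_conj_stabilizer[OF Ysub(1)] by simp
  hence Lst: "?L \<subseteq> conj_stabilizer G Y" using subgroup_conj_stabilizer by (rule generate_subgroup_incl)
  have YL: "Y \<lhd> G\<lparr>carrier := ?L\<rparr>"
    unfolding normal_in_subgroup_iff[OF L]
  proof (intro conjI ballI)
    show "subgroup Y G" "Y \<subseteq> ?L" using Ysub(1) incl by simp_all
    fix x k assume x: "x \<in> ?L" and k: "k \<in> Y"
    have "x \<in> conj_stabilizer G Y" using Lst x by (rule subsetD)
    thus "x \<otimes> k \<otimes> inv x \<in> Y" using k Y.mem_carrier[OF k] unfolding conj_stabilizer_def by blast
  qed
  have "Y \<subset> ?L" using incl c(2) by auto
  hence "\<Gamma> \<subseteq> ?L" by (rule Gamma_subset_above[OF Ysub(1,3) L])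
  hence "derived G \<Gamma> \<subseteq> derived G ?L" by (rule mono_derived)
  \<comment> \<open>\<open>Y\<close> is normal in \<open>?L\<close>, since \<open>c\<close>
    centralizes it, and the quotient is generated by the coset of \<open>c\<close>.\<close>
  moreover have "derived G ?L \<subseteq> Y"
  proof -
    have "generate (G\<lparr>carrier := ?L\<rparr>) (insert c Y) = carrier (G\<lparr>carrier := ?L\<rparr>)"
      using generate_consistent[OF incl L] by simp
    from group.derived_subset_if_cyclic_Mod[OF subgroup_imp_group[OF L] YL _ this]
    show ?thesis using incl derived_consistent[OF subset_refl L] by simp
  qed
  ultimately have "\<Gamma> \<subseteq> Y" unfolding Gamma_perfect by (rule subset_trans)
  hence eq: "\<Gamma> = Y" using Ymin[OF Gamma_subgroup _ Gamma_not_nilpotent] by simp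
  interpret \<Gamma>: group "G\<lparr>carrier := \<Gamma>\<rparr>" using Gamma_subgroup by (rule subgroup_imp_group)
  have "\<exists>Z. subgroup Z (G\<lparr>carrier := \<Gamma>\<rparr>) \<and> Z \<noteq> carrier (G\<lparr>carrier := \<Gamma>\<rparr>)
      \<and> \<not> nilpotent_group ((G\<lparr>carrier := \<Gamma>\<rparr>)\<lparr>carrier := Z\<rparr>)"
  proof (rule \<Gamma>.finite_perfect_has_non_nilpotent_proper_subgroup)
    show "finite (carrier (G\<lparr>carrier := \<Gamma>\<rparr>))" unfolding eq using finY by simp
    show "derived (G\<lparr>carrier := \<Gamma>\<rparr>) (carrier (G\<lparr>carrier := \<Gamma>\<rparr>)) = carrier (G\<lparr>carrier := \<Gamma>\<rparr>)"
      using derived_consistent[OF subset_refl Gamma_subgroup] Gamma_perfect by simp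
    show "carrier (G\<lparr>carrier := \<Gamma>\<rparr>) \<noteq> {\<one>\<^bsub>G\<lparr>carrier := \<Gamma>\<rparr>\<^esub>}"
      using exp_derived_Gamma_nontrivial[of 0] by simp
  qed
  then obtain Z where Z: "subgroup Z (G\<lparr>carrier := \<Gamma>\<rparr>)" "Z \<noteq> \<Gamma>" "\<not> nilpotent_group (G\<lparr>carrier := Z\<rparr>)" by auto
  have "subgroup Z G" "Z \<subseteq> \<Gamma>" using Z(1) unfolding subgroup_sub_iff[OF Gamma_subgroup] by simp_all
  hence "Z = Y" using Z(3) unfolding eq by (rule Ymin)
  thus False using Z(2) eq by simp
qed

text \<open>A conjugate \<open>?K\<close> not contained in \<open>H\<close> lies in the normal
  closure and so normalizes \<open>H\<close>. The finite subgroup \<open>?K <#> H\<close> properly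
  contains \<open>H\<close>, hence is normal and contains the closure.\<close>

lemma normal_closure_finite_if_normal_in_closure:
  assumes H: "subgroup H G" "finite H" "\<not> nilpotent_group (G\<lparr>carrier := H\<rparr>)" "\<not> H \<lhd> G"
    and nrm: "H \<lhd> G\<lparr>carrier := normal_closure G H\<rparr>"
  shows "finite (normal_closure G H)"
proof -
  interpret H: subgroup H G by fact
  obtain g x where gx: "g \<in> carrier G" "x \<in> H" "g \<otimes> x \<otimes> inv g \<notin> H"
    using H(1,4) unfolding normal_inv_iff by auto
  let ?K = "(\<lambda>y. g \<otimes> y \<otimes> inv g) ` H"
  have K: "subgroup ?K G" by (rule group_hom.subgroup_img_is_subgroup[OF conj_hom[OF gx(1)] H(1)])
  have Kcl: "?K \<subseteq> normal_closure G H"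
    by (rule image_subsetI) (rule normal_closure_conj[OF gx(1) _ H.subset])
  have KH: "subgroup (?K <#> H) G"
  proof (rule subgroup_set_mult_if_normalizes[OF K H(1)])
    fix k h assume k: "k \<in> ?K" and h: "h \<in> H"
    have kc: "k \<in> normal_closure G H" using Kcl k by (rule subsetD)
    have cl: "subgroup (normal_closure G H) G"
    proof (rule subgroupI)
      show "normal_closure G H \<subseteq> carrier G" unfolding normal_closure_def by auto
      show "normal_closure G H \<noteq> {}" using kc by auto
    qed (auto simp: normal_closure_def intro: subgroup.m_closed[OF normal_imp_subgroup]
        subgroup.m_inv_closed[OF normal_imp_subgroup])
    show "k \<otimes> h \<otimes> inv k \<in> H" using nrm kc h unfolding normal_in_subgroup_iff[OF cl] by simp
  qed
  note sub = subset_set_mult[OF K H(1)]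
  have "g \<otimes> x \<otimes> inv g \<in> ?K <#> H" using sub(1) imageI[OF gx(2)] by (rule subsetD)
  hence "H \<subset> ?K <#> H" using sub(2) gx(3) by auto
  hence "?K <#> H \<lhd> G" by (rule normal_if_above_non_nilpotent[OF H(1,3) KH])
  hence "normal_closure G H \<subseteq> ?K <#> H" using sub(2) by (rule normal_closure_subset)
  thus ?thesis by (rule finite_subset) (rule finite_set_mult[OF finite_imageI[OF H(2)] H(2)])
qed

text \<open>\<open>H\<close> provides the finite generating set; perfectness and nilpotency of the
  proper normal subgroups are already known, so the structure theory applies to \<Gamma>.\<close>

lemma Gamma_structure:
  assumes H: "subgroup H G" "finite H" "\<not> nilpotent_group (G\<lparr>carrier := H\<rparr>)" "\<not> H \<lhd> G"
  shows "finitely_generated_group (G\<lparr>carrier := \<Gamma>\<rparr>)"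
    and "is_simple_group ((G\<lparr>carrier := \<Gamma>\<rparr>) Mod fitting_subgroup (G\<lparr>carrier := \<Gamma>\<rparr>))"
    and "\<not> comm_group ((G\<lparr>carrier := \<Gamma>\<rparr>) Mod fitting_subgroup (G\<lparr>carrier := \<Gamma>\<rparr>))"
    and "minimal_non_nilpotent (G\<lparr>carrier := \<Gamma>\<rparr>) \<Longrightarrow>
      fitting_subgroup (G\<lparr>carrier := \<Gamma>\<rparr>) = frattini_subgroup (G\<lparr>carrier := \<Gamma>\<rparr>)"
proof -
  obtain S where S: "finite S" "S \<subseteq> \<Gamma>" "generate G S = \<Gamma>" using Gamma_finitely_generated[OF H] .
  have gen: "generate (G\<lparr>carrier := \<Gamma>\<rparr>) S = \<Gamma>" using generate_consistent[OF S(2) Gamma_subgroup] S(3) by simp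
  interpret \<Gamma>: perfect_with_nilpotent_normal_subgroups "G\<lparr>carrier := \<Gamma>\<rparr>" S
  proof (rule perfect_with_nilpotent_normal_subgroups.intro[OF subgroup_imp_group[OF Gamma_subgroup]], unfold_locales)
    show "derived (G\<lparr>carrier := \<Gamma>\<rparr>) (carrier (G\<lparr>carrier := \<Gamma>\<rparr>)) = carrier (G\<lparr>carrier := \<Gamma>\<rparr>)"
      using derived_consistent[OF subset_refl Gamma_subgroup] Gamma_perfect by simp
    show "carrier (G\<lparr>carrier := \<Gamma>\<rparr>) \<noteq> {\<one>\<^bsub>G\<lparr>carrier := \<Gamma>\<rparr>\<^esub>}"
      using exp_derived_Gamma_nontrivial[of 0] by simp
    show "nilpotent_group ((G\<lparr>carrier := \<Gamma>\<rparr>)\<lparr>carrier := K\<rparr>)"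
      if "K \<lhd> G\<lparr>carrier := \<Gamma>\<rparr>" "K \<noteq> carrier (G\<lparr>carrier := \<Gamma>\<rparr>)" for K
      using proper_normal_of_Gamma_nilpotent[of K] that by simp
  qed (use S gen in simp_all)
  show "finitely_generated_group (G\<lparr>carrier := \<Gamma>\<rparr>)"
    unfolding finitely_generated_group_def using \<Gamma>.generators by (intro exI[of _ S]) simp
  show "is_simple_group ((G\<lparr>carrier := \<Gamma>\<rparr>) Mod fitting_subgroup (G\<lparr>carrier := \<Gamma>\<rparr>))"
    by (rule \<Gamma>.Mod_fitting_simple)
  show "\<not> comm_group ((G\<lparr>carrier := \<Gamma>\<rparr>) Mod fitting_subgroup (G\<lparr>carrier := \<Gamma>\<rparr>))"
    by (rule \<Gamma>.Mod_fitting_not_comm)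
  show "fitting_subgroup (G\<lparr>carrier := \<Gamma>\<rparr>) = frattini_subgroup (G\<lparr>carrier := \<Gamma>\<rparr>)"
    if "minimal_non_nilpotent (G\<lparr>carrier := \<Gamma>\<rparr>)"
    by (rule \<Gamma>.fitting_eq_frattini) (use that in \<open>simp add: minimal_non_nilpotent_def\<close>)
qed

end

theorem mainTheorem13:
  fixes G :: "('a, 'b) monoid_scheme" and Xg :: "'a set"
  assumes grp: "group G"
    and pnh: "para_nil_hamiltonian G"
    and insol: "\<not> solvable G"
    and Xsub: "subgroup Xg G"
    and Xfin: "finite Xg"
    and Xnn: "\<not> nilpotent_group (G\<lparr>carrier := Xg\<rparr>)"
  shows "(finite (normal_closure G Xg) \<longrightarrow> finite (carrier G))
    \<and> ((normal Xg G \<or> (\<not> normal Xg G \<and> normal Xg (G\<lparr>carrier := normal_closure G Xg\<rparr>))) \<longrightarrow> finite (carrier G))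
    \<and> (infinite (normal_closure G Xg) \<longrightarrow>
         (let \<Gamma> = G\<lparr>carrier := lcs G 3\<rparr> in
           lcs G 3 = lcs_infty G
           \<and> finitely_generated_group \<Gamma>
           \<and> perfect_group \<Gamma>
           \<and> \<not> solvable \<Gamma>
           \<and> is_simple_group (\<Gamma> Mod fitting_subgroup \<Gamma>)
           \<and> \<not> comm_group (\<Gamma> Mod fitting_subgroup \<Gamma>)
           \<and> (minimal_non_nilpotent \<Gamma> \<longrightarrow> fitting_subgroup \<Gamma> = frattini_subgroup \<Gamma>)))"
proof -
  interpret insoluble_para_nil_hamiltonian G
    using grp pnh insol
    by (simp add: insoluble_para_nil_hamiltonian_def insoluble_para_nil_hamiltonian_axioms_def)
  have i: "finite (carrier G)" if "finite (normal_closure G Xg)"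
    using Xsub Xfin Xnn that by (rule finite_if_normal_closure_finite)
  have cl: "finite (normal_closure G Xg)" if "Xg \<lhd> G"
    using normal_closure_subset[OF that subset_refl] Xfin by (rule finite_subset)
  have ii: "finite (carrier G)"
    if "Xg \<lhd> G \<or> (\<not> Xg \<lhd> G \<and> Xg \<lhd> G\<lparr>carrier := normal_closure G Xg\<rparr>)"
    using that i cl normal_closure_finite_if_normal_in_closure[OF Xsub Xfin Xnn] by auto
  have perf: "perfect_group (G\<lparr>carrier := lcs G 3\<rparr>)"
    using derived_consistent[OF subset_refl Gamma_subgroup] Gamma_perfect by (simp add: perfect_group_def)
  \<comment> \<open>A normal \<open>Xg\<close> contains its own closure, which would then be
    finite.\<close>
  have nn: "\<not> Xg \<lhd> G" if "infinite (normal_closure G Xg)"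
    using cl that by auto
  show ?thesis
    unfolding Let_def
    using i ii perf Gamma_eq_lcs_infty Gamma_insoluble Gamma_structure[OF Xsub Xfin Xnn nn]
    by (intro conjI impI) simp_all
qed

end
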